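(* Let $I \subset \mathbb{R}$ be a bounded interval, let $N \in \mathbb{N}$, let $r \in (0,1)$, and let $a_i, b_i \in \mathbb{R}$ for $i \in \{1,\ldots,N\}$. For each $t \in I$ let $K_t \subset \mathbb{R}$ be the self-similar set associated with the homogeneous iterated function system $\{\psi_{i,t}(x) = r x + a_i + t b_i\}_{i \in \{1,\ldots,N\}}$ on $\mathbb{R}$. Let $X \subset \mathbb{R}^2$ be the self-similar set associated with the maps $F_i(x,y) = r(x,y) + (a_i,b_i)$, $i \in \{1,\ldots,N\}$, and let $s = \log N/\log r^{-1}$. Suppose that $\dim_{\mathrm{qA}} X \leq s$. Then, for every $\theta \in (0,1)$ and $\alpha \in [0,1)$, $$\dim_{\mathrm{H}} \biggl\{ t \in I : \dim_{\mathrm{A}}^{\theta} K_t > \frac{1}{1+\alpha}\biggl(\frac{s}{1-\theta} + \alpha s\biggr)\biggr\} \ \leq \ \alpha.$$ Moreover, for every $\theta \in (0,1)$, $$\dim_{\mathrm{A}}^{\theta} K_t \ \leq \ \frac{1}{2}\biggl(\frac{s}{1-\theta} + s\biggr)$$ for $\mathcal{L}^1$-almost all $t \in I$.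
   Context: The self-similar set associated with a finite family of contracting similarities $f_1,\ldots,f_N$ of $\mathbb{R}^m$ is the unique non-empty compact set $K$ with $K = \bigcup_{i=1}^N f_i(K)$. $\mathcal{L}^1$ is Lebesgue measure on $\mathbb{R}$. $\dim_{\mathrm{H}}$ is Hausdorff dimension (with $\dim_{\mathrm{H}} \emptyset = 0$). $B(x,R)$ is the closed ball with centre $x$ and radius $R$. $N_\rho(A)$ is the smallest number of closed balls of radius $\rho>0$ needed to cover the bounded set $A$. Assouad spectrum: for $X \subseteq \mathbb{R}^m$ and $\theta \in (0,1)$, $\dim_{\mathrm{A}}^\theta X$ is the infimum of all $\alpha \geq 0$ for which there exists a constant $C>0$ such that $N_{R^{1/\theta}}(X \cap B(x,R)) \leq C (R/R^{1/\theta})^\alpha$ for all $0<R<1$ and all $x \in X$. The quasi-Assouad dimension is $\dim_{\mathrm{qA}} X = \lim_{\theta \uparrow 1} \dim_{\mathrm{A}}^\theta X$ (this limit is known to exist). *)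

theory Defs
  imports "HOL-Analysis.Analysis"
begin

definition self_similar_set :: "'i set \<Rightarrow> ('i \<Rightarrow> 'a \<Rightarrow> 'a) \<Rightarrow> 'a::metric_space set" where
  "self_similar_set J f = (THE K. K \<noteq> {} \<and> compact K \<and> K = (\<Union>i\<in>J. f i ` K))"

text \<open>
  The \<open>d\<close>-th power of the diameter, with the usual conventions that the empty set contributes
  \<open>0\<close> and every non-empty set contributes \<open>1\<close> when \<open>d = 0\<close>
  (in the library \<open>0 powr 0 = 0\<close>, which is wrong for singletons).
\<close>
definition diam_pow :: "real \<Rightarrow> 'a::metric_space set \<Rightarrow> ennreal" where
  "diam_pow d U = (if U = {} then 0 else if d = 0 then 1 else ennreal (diameter U powr d))"

text \<open>
  Covers are indexed by all of \<open>nat\<close>; finite covers are padded with empty sets.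
  Boundedness is required explicitly because \<open>diameter\<close> is unspecified on unbounded sets.
\<close>
definition hausdorff_premeasure :: "real \<Rightarrow> real \<Rightarrow> 'a::metric_space set \<Rightarrow> ennreal" where
  "hausdorff_premeasure \<delta> d A =
     (INF U \<in> {U :: nat \<Rightarrow> 'a set. A \<subseteq> (\<Union>n. U n) \<and> (\<forall>n. bounded (U n) \<and> diameter (U n) \<le> \<delta>)}.
        (\<Sum>n. diam_pow d (U n)))"

definition hausdorff_measure :: "real \<Rightarrow> 'a::metric_space set \<Rightarrow> ennreal" where
  "hausdorff_measure d A = (SUP \<delta>\<in>{0<..}. hausdorff_premeasure \<delta> d A)"

definition hausdorff_dim :: "'a::metric_space set \<Rightarrow> ereal" where
  "hausdorff_dim A = Inf {ereal d |d. 0 \<le> d \<and> hausdorff_measure d A = 0}"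

lemma hausdorff_dim_empty: "hausdorff_dim ({} :: 'a::metric_space set) = 0"
proof -
  have "hausdorff_premeasure \<delta> d ({} :: 'a set) = 0" if "\<delta> > 0" for \<delta> d :: real
  proof -
    have "hausdorff_premeasure \<delta> d ({} :: 'a set) \<le> (\<Sum>n. diam_pow d ((\<lambda>_::nat. {} :: 'a set) n))"
      unfolding hausdorff_premeasure_def using that by (intro INF_lower) auto
    also have "\<dots> = 0" by (simp add: diam_pow_def)
    finally show ?thesis by simp
  qed
  then have "hausdorff_measure d ({} :: 'a set) = 0" for d
    by (auto simp: hausdorff_measure_def intro!: SUP_eq_const)
  then show ?thesis
    unfolding hausdorff_dim_def
    by (intro antisym Inf_lower Inf_greatest) (auto simp: zero_ereal_def)
qed

text \<open>Meaningful for totally bounded \<open>A\<close>; the centres need not lie in \<open>A\<close>.\<close>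
definition covering_number :: "real \<Rightarrow> 'a::metric_space set \<Rightarrow> nat" where
  "covering_number \<rho> A = (LEAST n. \<exists>C. finite C \<and> card C = n \<and> A \<subseteq> (\<Union>c\<in>C. cball c \<rho>))"

definition assouad_spectrum :: "real \<Rightarrow> 'a::euclidean_space set \<Rightarrow> real" where
  "assouad_spectrum \<theta> X =
     Inf {\<alpha>. 0 \<le> \<alpha> \<and> (\<exists>C>0. \<forall>R x. 0 < R \<and> R < 1 \<and> x \<in> X \<longrightarrow>
            real (covering_number (R powr (1 / \<theta>)) (X \<inter> cball x R))
              \<le> C * (R / R powr (1 / \<theta>)) powr \<alpha>)}"

definition quasi_assouad_dim :: "'a::euclidean_space set \<Rightarrow> real" where
  "quasi_assouad_dim X = Lim (at_left 1) (\<lambda>\<theta>. assouad_spectrum \<theta> X)"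

end

theory Submission
  imports Defs
begin

text \<open>
  \<open>K t\<close> is the image of \<open>X\<close> under the projection \<open>\<pi>\<^sub>t (x, y) = x + t * y\<close>.
  Assouad spectra of plane sets converge to their supremum as \<open>\<theta> \<rightarrow> 1\<close>, so the hypothesis bounds the
  number of \<open>\<rho>\<close>-cells of \<open>X\<close> in any ball of radius \<open>d\<close> by \<open>\<rho>\<^sup>-\<^sup>\<eta> (d / \<rho>)\<^sup>s\<close>, for every \<open>\<eta> > 0\<close>. Hence
  \<open>\<pi>\<^sub>t X\<close> meets an interval of length \<open>R\<close> in about \<open>M (R / \<rho>)\<^sup>s\<close> intervals of length \<open>\<rho>\<close>, where \<open>M\<close> is the
  number of \<open>R\<close>-cells of \<open>X\<close> in the corresponding strip, and the claim amounts to
  \<open>M \<le> R powr (- s / (1 + \<alpha>) - \<epsilon>)\<close> for all small \<open>R\<close>, outside a set of directions of dimension at most \<open>\<alpha>\<close>.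
  For \<open>s > 1\<close> it is trivial, since subsets of the line have spectrum at most \<open>1\<close>. For \<open>s \<le> 1\<close>, choose a
  strip with \<open>m\<close> cells for each exceptional direction. The strips of \<open>t\<close> and \<open>t'\<close> share at most
  \<open>min m (1 / \<bar>t - t'\<bar>) \<le> m powr (1 - \<alpha>) * \<bar>t - t'\<bar> powr (- \<alpha>)\<close> cells, up to \<open>R\<^sup>-\<^sup>\<eta>\<close>, and integrating
  this against a Frostman weight \<open>w\<close> of exponent \<open>\<alpha>\<close> gives, by Cauchy--Schwarz, that \<open>w\<close> has mass at most
  \<open>R\<^sup>-\<^sup>s m powr (- 1 - \<alpha>)\<close>. So the exceptional directions at scale \<open>R\<close> have \<open>\<alpha>\<close>-content at most a
  positive power of \<open>R\<close>, and the Borel--Cantelli lemma applies.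
\<close>

section \<open>Counting grid cells\<close>

text \<open>The index of the half-open mesh square of side \<open>\<rho>\<close> that contains
  \<open>p\<close>. Mesh squares are canonical, unlike the balls of an optimal cover, so the squares
  met by two strips can be intersected and counted.\<close>

definition grid :: "real \<Rightarrow> real \<times> real \<Rightarrow> int \<times> int" where
  "grid \<rho> p = (\<lfloor>fst p / \<rho>\<rfloor>, \<lfloor>snd p / \<rho>\<rfloor>)"

lemma card_floor_interval_le:
  fixes x y :: real
  assumes "x \<le> y"
  shows "real (card {\<lfloor>x\<rfloor>..\<lfloor>y\<rfloor>}) \<le> y - x + 2"
proof -
  have "\<lfloor>x\<rfloor> \<le> \<lfloor>y\<rfloor>" using assms by (rule floor_mono)
  then have "real (card {\<lfloor>x\<rfloor>..\<lfloor>y\<rfloor>}) = of_int \<lfloor>y\<rfloor> - of_int \<lfloor>x\<rfloor> + 1" by simp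
  then show ?thesis by linarith
qed

lemma grid_cball:
  assumes "0 < \<rho>" "0 \<le> d"
  shows "finite (grid \<rho> ` cball y d)"
    and "real (card (grid \<rho> ` cball y d)) \<le> (2 * d / \<rho> + 2)\<^sup>2"
proof -
  define J where "J c = {\<lfloor>(c - d) / \<rho>\<rfloor>..\<lfloor>(c + d) / \<rho>\<rfloor>}" for c
  have J: "real (card (J c)) \<le> 2 * d / \<rho> + 2" for c
  proof -
    have "(c - d) / \<rho> \<le> (c + d) / \<rho>" using assms by (simp add: divide_right_mono)
    then have "real (card (J c)) \<le> (c + d) / \<rho> - (c - d) / \<rho> + 2"
      unfolding J_def by (rule card_floor_interval_le)
    also have "\<dots> = 2 * d / \<rho> + 2" by (simp add: diff_divide_distrib add_divide_distrib)
    finally show ?thesis .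
  qed
  have sub: "grid \<rho> ` cball y d \<subseteq> J (fst y) \<times> J (snd y)"
  proof
    fix c assume "c \<in> grid \<rho> ` cball y d"
    then obtain p where p: "dist y p \<le> d" "c = grid \<rho> p" by auto
    have "\<bar>fst y - fst p\<bar> \<le> d" "\<bar>snd y - snd p\<bar> \<le> d"
      using dist_fst_le[of y p] dist_snd_le[of y p] p(1) by (auto simp: dist_real_def)
    then show "c \<in> J (fst y) \<times> J (snd y)"
      using assms by (auto simp: p J_def grid_def intro!: floor_mono divide_right_mono)
  qed
  have fin: "finite (J (fst y) \<times> J (snd y))" by (simp add: J_def)
  show "finite (grid \<rho> ` cball y d)" using sub fin by (rule finite_subset)
  have "real (card (grid \<rho> ` cball y d)) \<le> real (card (J (fst y) \<times> J (snd y)))"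
    using card_mono[OF fin sub] by simp
  also have "\<dots> = real (card (J (fst y))) * real (card (J (snd y)))" by (simp add: card_cartesian_product)
  also have "\<dots> \<le> (2 * d / \<rho> + 2) * (2 * d / \<rho> + 2)"
    using assms by (intro mult_mono J) auto
  finally show "real (card (grid \<rho> ` cball y d)) \<le> (2 * d / \<rho> + 2)\<^sup>2" by (simp add: power2_eq_square)
qed

lemma finite_grid:
  assumes "0 < \<rho>" "bounded A"
  shows "finite (grid \<rho> ` A)"
proof -
  obtain d where "0 < d" "A \<subseteq> cball 0 d"
    using assms(2) by (meson ball_subset_cball bounded_subset_ballD order_trans)
  then show ?thesis
    using grid_cball(1)[OF assms(1), of d 0] by (meson finite_subset image_mono less_imp_le)
qed

lemma card_grid_mono:
  assumes "0 < \<rho>" "bounded B" "A \<subseteq> B"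
  shows "card (grid \<rho> ` A) \<le> card (grid \<rho> ` B)"
  using assms by (intro card_mono finite_grid image_mono) auto

lemma card_grid_cball_Int:
  assumes "0 < \<rho>" "0 \<le> d"
  shows "real (card (grid \<rho> ` (A \<inter> cball y d))) \<le> (2 * d / \<rho> + 2)\<^sup>2"
proof -
  have "card (grid \<rho> ` (A \<inter> cball y d)) \<le> card (grid \<rho> ` cball y d)"
    using assms by (intro card_grid_mono) auto
  then show ?thesis using grid_cball(2)[OF assms, of y] by linarith
qed

lemma floor_divide_eq_imp_close:
  fixes x y \<rho> :: real
  assumes "0 < \<rho>" "\<lfloor>x / \<rho>\<rfloor> = \<lfloor>y / \<rho>\<rfloor>"
  shows "\<bar>x - y\<bar> \<le> \<rho>"
proof -
  have "\<bar>x / \<rho> - y / \<rho>\<bar> \<le> 1" using assms(2) by linarith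
  then show ?thesis using assms(1) by (simp add: field_simps abs_le_iff)
qed

lemma grid_eq_imp_close:
  assumes "0 < \<rho>" "grid \<rho> p = grid \<rho> q"
  shows "\<bar>fst p - fst q\<bar> \<le> \<rho>" "\<bar>snd p - snd q\<bar> \<le> \<rho>" "dist p q \<le> 2 * \<rho>"
proof -
  show *: "\<bar>fst p - fst q\<bar> \<le> \<rho>" "\<bar>snd p - snd q\<bar> \<le> \<rho>"
    using assms by (auto simp: grid_def intro!: floor_divide_eq_imp_close)
  have "dist p q \<le> dist (fst p) (fst q) + dist (snd p) (snd q)"
    unfolding dist_prod_def by (rule sqrt_sum_squares_le_sum) auto
  then show "dist p q \<le> 2 * \<rho>" using * by (simp add: dist_real_def)
qed

section \<open>Covering numbers against cell counts, and changes of mesh size\<close>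

lemma covering_number_le_card:
  assumes "finite C" "A \<subseteq> (\<Union>c\<in>C. cball c \<rho>)"
  shows "covering_number \<rho> A \<le> card C"
  unfolding covering_number_def using assms by (intro Least_le) auto

text \<open>\<open>LEAST\<close> is informative only when some finite cover exists, so one is
  supplied before a minimal cover is extracted.\<close>

lemma covering_number_attained:
  assumes "finite C" "A \<subseteq> (\<Union>c\<in>C. cball c \<rho>)"
  obtains D where "finite D" "card D = covering_number \<rho> A" "A \<subseteq> (\<Union>c\<in>D. cball c \<rho>)"
proof -
  have "\<exists>n. \<exists>C. finite C \<and> card C = n \<and> A \<subseteq> (\<Union>c\<in>C. cball c \<rho>)" using assms by blast
  from LeastI_ex[OF this] show ?thesis
    unfolding covering_number_def[symmetric] using that by blast
qed

lemma grid_cover: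
  assumes "0 < \<rho>" "bounded A"
  obtains C where "finite C" "card C \<le> card (grid \<rho> ` A)" "A \<subseteq> (\<Union>c\<in>C. cball c \<rho>)"
proof
  \<comment> \<open>Centres of the mesh squares. Each coordinate of a point differs from that of its
    centre by at most \<open>\<rho> / 2\<close>, so even the sum of the two differences is at most
    \<open>\<rho>\<close>.\<close>
  define z where "z c = ((of_int (fst c) + 1/2) * \<rho>, (of_int (snd c) + 1/2) * \<rho>)" for c :: "int \<times> int"
  show "finite (z ` grid \<rho> ` A)" using finite_grid[OF assms] by simp
  show "card (z ` grid \<rho> ` A) \<le> card (grid \<rho> ` A)" using finite_grid[OF assms] by (rule card_image_le)
  have half: "\<bar>(of_int \<lfloor>x / \<rho>\<rfloor> + 1/2) * \<rho> - x\<bar> \<le> \<rho> / 2" for x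
  proof -
    have "\<bar>of_int \<lfloor>x / \<rho>\<rfloor> + 1/2 - x / \<rho>\<bar> \<le> 1/2" by linarith
    then have "\<bar>of_int \<lfloor>x / \<rho>\<rfloor> + 1/2 - x / \<rho>\<bar> * \<rho> \<le> 1/2 * \<rho>" using assms(1) by (intro mult_right_mono) auto
    also have "\<bar>of_int \<lfloor>x / \<rho>\<rfloor> + 1/2 - x / \<rho>\<bar> * \<rho> = \<bar>(of_int \<lfloor>x / \<rho>\<rfloor> + 1/2 - x / \<rho>) * \<rho>\<bar>"
      using assms(1) by (simp add: abs_mult)
    also have "(of_int \<lfloor>x / \<rho>\<rfloor> + 1/2 - x / \<rho>) * \<rho> = (of_int \<lfloor>x / \<rho>\<rfloor> + 1/2) * \<rho> - x"
      using assms(1) by (simp add: left_diff_distrib)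
    finally show ?thesis by simp
  qed
  show "A \<subseteq> (\<Union>c\<in>z ` grid \<rho> ` A. cball c \<rho>)"
  proof
    fix p assume p: "p \<in> A"
    have "dist (z (grid \<rho> p)) p \<le> dist (fst (z (grid \<rho> p))) (fst p) + dist (snd (z (grid \<rho> p))) (snd p)"
      unfolding dist_prod_def by (rule sqrt_sum_squares_le_sum) auto
    also have "\<dots> \<le> \<rho> / 2 + \<rho> / 2"
      using half[of "fst p"] half[of "snd p"] unfolding z_def grid_def dist_real_def by simp
    finally show "p \<in> (\<Union>c\<in>z ` grid \<rho> ` A. cball c \<rho>)" using p by auto
  qed
qed

lemma covering_number_le_grid:
  assumes "0 < \<rho>" "bounded A"
  shows "covering_number \<rho> A \<le> card (grid \<rho> ` A)"
  using grid_cover[OF assms] covering_number_le_card by (metis le_trans)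

text \<open>Each disc of radius \<open>\<rho>\<close> in an optimal cover meets at most
  \<open>(2 + 2)\<^sup>2 = 16\<close> squares of the mesh.\<close>

lemma grid_le_covering_number:
  assumes "0 < \<rho>" "bounded A"
  shows "card (grid \<rho> ` A) \<le> 16 * covering_number \<rho> A"
proof -
  obtain C where C: "finite C" "card C = covering_number \<rho> A" "A \<subseteq> (\<Union>c\<in>C. cball c \<rho>)"
    using grid_cover[OF assms] covering_number_attained by metis
  have 16: "card (grid \<rho> ` cball c \<rho>) \<le> 16" for c
    using grid_cball(2)[of \<rho> \<rho> c] assms(1) by simp
  have "card (grid \<rho> ` A) \<le> card (\<Union>c\<in>C. grid \<rho> ` cball c \<rho>)"
  proof (intro card_mono)
    show "finite (\<Union>c\<in>C. grid \<rho> ` cball c \<rho>)" using C(1) assms(1) by (intro finite_UN_I finite_grid) auto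
    show "grid \<rho> ` A \<subseteq> (\<Union>c\<in>C. grid \<rho> ` cball c \<rho>)" using C(3) by blast
  qed
  also have "\<dots> \<le> (\<Sum>c\<in>C. card (grid \<rho> ` cball c \<rho>))" using C(1) by (rule card_UN_le)
  also have "\<dots> \<le> (\<Sum>c\<in>C. 16)" by (intro sum_mono 16)
  finally show ?thesis using C(2) by simp
qed

text \<open>The points of \<open>A\<close> in one \<open>\<sigma>\<close>-cell lie in a ball of
  radius \<open>2 * \<sigma>\<close> about any one of them, so the \<open>\<rho>\<close>-cells can
  be counted one \<open>\<sigma>\<close>-cell at a time. The centres are points of \<open>A\<close>
  because the spectrum controls only balls centred in the set.\<close>

lemma card_grid_split:
  assumes "0 < \<rho>" "0 < \<sigma>" "bounded A"
    and B: "\<And>y. y \<in> A \<Longrightarrow> real (card (grid \<rho> ` (A \<inter> cball y (2 * \<sigma>)))) \<le> B"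
  shows "real (card (grid \<rho> ` A)) \<le> real (card (grid \<sigma> ` A)) * B"
proof -
  define F where "F c = {p \<in> A. grid \<sigma> p = c}" for c
  have fin: "finite (grid \<sigma> ` A)" using assms by (intro finite_grid)
  have F: "real (card (grid \<rho> ` F c)) \<le> B" if "c \<in> grid \<sigma> ` A" for c
  proof -
    obtain y where y: "y \<in> A" "grid \<sigma> y = c" using \<open>c \<in> grid \<sigma> ` A\<close> by blast
    have "F c \<subseteq> A \<inter> cball y (2 * \<sigma>)"
      using y assms(2) by (auto simp: F_def intro!: grid_eq_imp_close)
    then have "card (grid \<rho> ` F c) \<le> card (grid \<rho> ` (A \<inter> cball y (2 * \<sigma>)))"
      using assms by (intro card_grid_mono) auto
    with B[OF y(1)] show ?thesis by linarith
  qed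
  have "grid \<rho> ` A = (\<Union>c\<in>grid \<sigma> ` A. grid \<rho> ` F c)" by (auto simp: F_def)
  then have "card (grid \<rho> ` A) \<le> (\<Sum>c\<in>grid \<sigma> ` A. card (grid \<rho> ` F c))"
    using card_UN_le[OF fin] by metis
  then have "real (card (grid \<rho> ` A)) \<le> (\<Sum>c\<in>grid \<sigma> ` A. real (card (grid \<rho> ` F c)))"
    by (metis of_nat_le_iff of_nat_sum)
  also have "\<dots> \<le> (\<Sum>c\<in>grid \<sigma> ` A. B)" by (intro sum_mono F)
  finally show ?thesis by simp
qed

text \<open>\<open>card_grid_split\<close> produces balls of radius twice the mesh size. Halving the
  mesh, at the cost of the factor \<open>(8 + 2)\<^sup>2 = 100\<close>, makes that radius equal to
  the original scale.\<close>

lemma card_grid_half: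
  assumes "0 < \<sigma>" "bounded A"
  shows "real (card (grid (\<sigma> / 2) ` A)) \<le> real (card (grid \<sigma> ` A)) * 100"
proof (rule card_grid_split)
  fix y assume "y \<in> A"
  show "real (card (grid (\<sigma> / 2) ` (A \<inter> cball y (2 * \<sigma>)))) \<le> 100"
    using card_grid_cball_Int[of "\<sigma> / 2" "2 * \<sigma>" A y] assms by simp
qed (use assms in auto)

section \<open>The Assouad spectrum of plane sets\<close>

definition spectrum_exponents :: "real \<Rightarrow> 'a::euclidean_space set \<Rightarrow> real set" where
  "spectrum_exponents \<theta> X = {\<alpha>. 0 \<le> \<alpha> \<and> (\<exists>C>0. \<forall>R x. 0 < R \<and> R < 1 \<and> x \<in> X \<longrightarrow>
     real (covering_number (R powr (1 / \<theta>)) (X \<inter> cball x R)) \<le> C * (R / R powr (1 / \<theta>)) powr \<alpha>)}"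

lemma assouad_spectrum_eq_Inf: "assouad_spectrum \<theta> X = Inf (spectrum_exponents \<theta> X)"
  by (simp add: assouad_spectrum_def spectrum_exponents_def)

lemma bdd_below_spectrum_exponents: "bdd_below (spectrum_exponents \<theta> X)"
  by (rule bdd_belowI[of _ 0]) (simp add: spectrum_exponents_def)

lemma assouad_spectrum_le:
  assumes "0 \<le> \<alpha>" "0 < C"
    and "\<And>R x. 0 < R \<Longrightarrow> R < 1 \<Longrightarrow> x \<in> X \<Longrightarrow>
      real (covering_number (R powr (1 / \<theta>)) (X \<inter> cball x R)) \<le> C * (R / R powr (1 / \<theta>)) powr \<alpha>"
  shows "\<alpha> \<in> spectrum_exponents \<theta> X" "assouad_spectrum \<theta> X \<le> \<alpha>"
proof -
  show "\<alpha> \<in> spectrum_exponents \<theta> X" unfolding spectrum_exponents_def using assms by blast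
  then show "assouad_spectrum \<theta> X \<le> \<alpha>"
    unfolding assouad_spectrum_eq_Inf using bdd_below_spectrum_exponents by (rule cInf_lower)
qed

lemma powr_inverse_le_self:
  fixes R \<theta> :: real
  assumes "0 < R" "R < 1" "0 < \<theta>" "\<theta> < 1"
  shows "R powr (1 / \<theta>) \<le> R"
  using powr_mono'[of 1 "1 / \<theta>" R] assms by simp

text \<open>A ball of radius \<open>R\<close> meets at most a multiple of
  \<open>(R / \<rho>)\<^sup>2\<close> cells of a planar mesh. This makes the set of exponents
  non-empty, without which its infimum would carry no information.\<close>

lemma two_in_spectrum_exponents:
  fixes X :: "(real \<times> real) set"
  assumes \<theta>: "0 < \<theta>" "\<theta> < 1"
  shows "2 \<in> spectrum_exponents \<theta> X"
proof (rule assouad_spectrum_le(1)[of _ 16])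
  fix R :: real and x assume R: "0 < R" "R < 1"
  define \<rho> where "\<rho> = R powr (1 / \<theta>)"
  have \<rho>: "0 < \<rho>" "\<rho> \<le> R" using R powr_inverse_le_self[OF R \<theta>] by (auto simp: \<rho>_def)
  have "covering_number \<rho> (X \<inter> cball x R) \<le> card (grid \<rho> ` (X \<inter> cball x R))"
    using \<rho> by (intro covering_number_le_grid) (auto intro: bounded_subset[OF bounded_cball])
  then have "real (covering_number \<rho> (X \<inter> cball x R)) \<le> (2 * R / \<rho> + 2)\<^sup>2"
    using card_grid_cball_Int[of \<rho> R X x] \<rho> R by linarith
  also have "\<dots> \<le> (4 * (R / \<rho>))\<^sup>2" using \<rho> by (intro power_mono) (auto simp: field_simps)
  also have "\<dots> = 16 * (R / \<rho>) powr 2" using \<rho> R by (simp add: power_divide power_mult_distrib)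
  finally show "real (covering_number \<rho> (X \<inter> cball x R)) \<le> 16 * (R / \<rho>) powr 2" .
qed auto

lemma assouad_spectrum_plane_bounds:
  fixes X :: "(real \<times> real) set"
  assumes \<theta>: "0 < \<theta>" "\<theta> < 1"
  shows "0 \<le> assouad_spectrum \<theta> X" "assouad_spectrum \<theta> X \<le> 2"
proof -
  note two = two_in_spectrum_exponents[OF \<theta>, of X]
  show "assouad_spectrum \<theta> X \<le> 2"
    unfolding assouad_spectrum_eq_Inf using two bdd_below_spectrum_exponents by (rule cInf_lower)
  show "0 \<le> assouad_spectrum \<theta> X"
    unfolding assouad_spectrum_eq_Inf
  proof (rule cInf_greatest)
    show "spectrum_exponents \<theta> X \<noteq> {}" using two by blast
  qed (simp add: spectrum_exponents_def)
qed

text \<open>The infimum need not be an admissible exponent, but some admissible exponent lies below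
  \<open>\<beta>\<close>, and \<open>R / \<rho> \<ge> 1\<close> allows it to be raised to
  \<open>\<beta>\<close>.\<close>

lemma grid_bound_at_spectrum_scale:
  fixes X :: "(real \<times> real) set"
  assumes \<theta>: "0 < \<theta>" "\<theta> < 1" and \<beta>: "assouad_spectrum \<theta> X < \<beta>"
  obtains C where "0 < C" "\<And>R y. 0 < R \<Longrightarrow> R < 1 \<Longrightarrow> y \<in> X \<Longrightarrow>
      real (card (grid (R powr (1 / \<theta>)) ` (X \<inter> cball y R))) \<le> C * (R / R powr (1 / \<theta>)) powr \<beta>"
proof -
  obtain \<alpha> where \<alpha>: "\<alpha> \<in> spectrum_exponents \<theta> X" "\<alpha> < \<beta>"
    using \<beta> two_in_spectrum_exponents[OF \<theta>, of X] cInf_lessD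
    unfolding assouad_spectrum_eq_Inf by blast
  then obtain C where C: "0 < C" "\<And>R y. 0 < R \<Longrightarrow> R < 1 \<Longrightarrow> y \<in> X \<Longrightarrow>
      real (covering_number (R powr (1 / \<theta>)) (X \<inter> cball y R)) \<le> C * (R / R powr (1 / \<theta>)) powr \<alpha>"
    unfolding spectrum_exponents_def by blast
  show thesis
  proof (rule that[of "16 * C"])
    fix R :: real and y assume R: "0 < R" "R < 1" "y \<in> X"
    define \<rho> where "\<rho> = R powr (1 / \<theta>)"
    have \<rho>: "0 < \<rho>" "\<rho> \<le> R" using R powr_inverse_le_self[OF R(1,2) \<theta>] by (auto simp: \<rho>_def)
    have "card (grid \<rho> ` (X \<inter> cball y R)) \<le> 16 * covering_number \<rho> (X \<inter> cball y R)"
      using \<rho> by (intro grid_le_covering_number) (auto intro: bounded_subset[OF bounded_cball])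
    then have "real (card (grid \<rho> ` (X \<inter> cball y R))) \<le> 16 * real (covering_number \<rho> (X \<inter> cball y R))"
      by linarith
    also have "\<dots> \<le> 16 * (C * (R / \<rho>) powr \<alpha>)" using C(2)[OF R] by (simp add: \<rho>_def)
    also have "(R / \<rho>) powr \<alpha> \<le> (R / \<rho>) powr \<beta>" using \<rho> \<alpha>(2) by (intro powr_mono) auto
    finally show "real (card (grid \<rho> ` (X \<inter> cball y R))) \<le> 16 * C * (R / \<rho>) powr \<beta>"
      using C(1) by simp
  qed (use C(1) in simp)
qed

text \<open>Chaining the spectrum bound along the scales \<open>d, d powr (1/\<theta>), d powr (1/\<theta>\<^sup>2), \<dots>\<close>; the power of
  \<open>\<rho>\<close> absorbs the last, incomplete, step.\<close>
lemma grid_bound_chain: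
  fixes X :: "(real \<times> real) set"
  assumes \<theta>: "0 < \<theta>" "\<theta> < 1" and \<beta>: "assouad_spectrum \<theta> X < \<beta>"
  shows "\<exists>C>0. \<forall>d \<rho> y. 0 < d \<and> d < 1 \<and> d powr (1 / \<theta> ^ k) \<le> \<rho> \<and> \<rho> \<le> d \<and> y \<in> X \<longrightarrow>
      real (card (grid \<rho> ` (X \<inter> cball y d))) \<le> C * (d / \<rho>) powr \<beta> * \<rho> powr (- 2 * (1 / \<theta> - 1))"
proof -
  define \<eta> where "\<eta> = 2 * (1 / \<theta> - 1)"
  have \<eta>: "0 \<le> \<eta>" using \<theta> by (simp add: \<eta>_def field_simps)
  have "0 \<le> \<beta>" using assouad_spectrum_plane_bounds[OF \<theta>, of X] \<beta> by simp
  obtain C0 where C0: "0 < C0" "\<And>R y. 0 < R \<Longrightarrow> R < 1 \<Longrightarrow> y \<in> X \<Longrightarrow>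
      real (card (grid (R powr (1 / \<theta>)) ` (X \<inter> cball y R))) \<le> C0 * (R / R powr (1 / \<theta>)) powr \<beta>"
    using grid_bound_at_spectrum_scale[OF \<theta> \<beta>] by blast
  \<comment> \<open>Within a single step of the chain the quadratic bound is enough: here
    \<open>d / \<rho> \<le> \<rho> powr (1 - 1 / \<theta>)\<close>, and the square of the right-hand
    side is \<open>\<rho> powr (-\<eta>)\<close>.\<close>
  have short: "real (card (grid \<rho> ` (X \<inter> cball y d))) \<le> 16 * (d / \<rho>) powr \<beta> * \<rho> powr (-\<eta>)"
    if "0 < d" "d < 1" "d powr (1 / \<theta>) \<le> \<rho>" "\<rho> \<le> d" for d \<rho> y
  proof -
    have \<rho>: "0 < \<rho>" "\<rho> < 1" using that by (smt (verit) powr_gt_zero)+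
    have "d \<le> \<rho> powr \<theta>"
    proof -
      have "(d powr (1 / \<theta>)) powr \<theta> \<le> \<rho> powr \<theta>" using that \<theta> by (intro powr_mono2) auto
      then show ?thesis using that \<theta> by (simp add: powr_powr)
    qed
    \<comment> \<open>This is \<open>\<theta> + 1 / \<theta> \<ge> 2\<close>; it brings the loss
      into the form used for \<open>\<eta>\<close>.\<close>
    have "\<rho> powr \<theta> \<le> \<rho> powr (2 - 1 / \<theta>)"
    proof (rule powr_mono')
      have "0 \<le> (\<theta> - 1)\<^sup>2 / \<theta>" using \<theta> by simp
      also have "(\<theta> - 1)\<^sup>2 / \<theta> = \<theta> - 2 + 1 / \<theta>" using \<theta> by (simp add: power2_eq_square field_simps)
      finally show "2 - 1 / \<theta> \<le> \<theta>" by simp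
    qed (use \<rho> in auto)
    then have "d / \<rho> \<le> \<rho> powr (2 - 1 / \<theta>) / \<rho> powr 1"
      using \<open>d \<le> \<rho> powr \<theta>\<close> \<rho> by (intro frac_le) auto
    also have "\<dots> = \<rho> powr (1 - 1 / \<theta>)" by (simp only: powr_diff[symmetric]) simp
    finally have le: "d / \<rho> \<le> \<rho> powr (1 - 1 / \<theta>)" .
    have "real (card (grid \<rho> ` (X \<inter> cball y d))) \<le> (2 * d / \<rho> + 2)\<^sup>2"
      using that \<rho> by (intro card_grid_cball_Int) auto
    also have "\<dots> \<le> (4 * (d / \<rho>))\<^sup>2" using \<rho> that by (intro power_mono) (auto simp: field_simps)
    also have "\<dots> \<le> (4 * \<rho> powr (1 - 1 / \<theta>))\<^sup>2" using le \<rho> that by (intro power_mono) auto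
    also have "\<dots> = 16 * \<rho> powr (-\<eta>)"
      using \<rho> by (simp add: power_mult_distrib power2_eq_square \<eta>_def algebra_simps flip: powr_add)
    also have "\<dots> \<le> 16 * (d / \<rho>) powr \<beta> * \<rho> powr (-\<eta>)"
      using \<rho> that \<open>0 \<le> \<beta>\<close> by (simp add: ge_one_powr_ge_zero)
    finally show ?thesis .
  qed
  show ?thesis unfolding mult_minus_left \<eta>_def[symmetric]
  proof (induction k)
    case 0
    have "d powr (1 / \<theta>) \<le> \<rho>" if "0 < d" "d < 1" "d powr (1 / \<theta> ^ 0) \<le> \<rho>" for d \<rho>
      using powr_inverse_le_self[OF that(1,2) \<theta>] that by simp
    then have "\<forall>d \<rho> y. 0 < d \<and> d < 1 \<and> d powr (1 / \<theta> ^ 0) \<le> \<rho> \<and> \<rho> \<le> d \<and> y \<in> X \<longrightarrow>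
        real (card (grid \<rho> ` (X \<inter> cball y d))) \<le> 16 * (d / \<rho>) powr \<beta> * \<rho> powr (-\<eta>)"
      by (intro allI impI short) blast+
    then show ?case by (intro exI[of _ 16] conjI) simp
  next
    case (Suc k)
    then obtain C where C: "0 < C" "\<And>d \<rho> y. 0 < d \<Longrightarrow> d < 1 \<Longrightarrow> d powr (1 / \<theta> ^ k) \<le> \<rho> \<Longrightarrow> \<rho> \<le> d \<Longrightarrow> y \<in> X \<Longrightarrow>
      real (card (grid \<rho> ` (X \<inter> cball y d))) \<le> C * (d / \<rho>) powr \<beta> * \<rho> powr (-\<eta>)" by blast
    have "real (card (grid \<rho> ` (X \<inter> cball y d))) \<le> max 16 (100 * C0 * C) * (d / \<rho>) powr \<beta> * \<rho> powr (-\<eta>)"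
      if d: "0 < d" "d < 1" "d powr (1 / \<theta> ^ Suc k) \<le> \<rho>" "\<rho> \<le> d" "y \<in> X" for d \<rho> y
    proof (cases "d powr (1 / \<theta>) \<le> \<rho>")
      case True
      have "16 * ((d / \<rho>) powr \<beta> * \<rho> powr (-\<eta>)) \<le> max 16 (100 * C0 * C) * ((d / \<rho>) powr \<beta> * \<rho> powr (-\<eta>))"
        by (intro mult_right_mono) auto
      then show ?thesis using short[OF d(1,2) True d(4), of y] by (simp add: mult.assoc)
    next
      case False
      \<comment> \<open>One use of the spectrum bound leads from \<open>d\<close> to
        \<open>d'\<close>, and the induction hypothesis from \<open>d'\<close> to
        \<open>\<rho>\<close>. The ratios telescope, and the loss
        \<open>\<rho> powr (-\<eta>)\<close> is incurred once, not once per step.\<close>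
      define d' where "d' = d powr (1 / \<theta>)"
      have d': "0 < d'" "d' < 1" "\<rho> \<le> d'" "d' \<le> d"
        using False d powr_inverse_le_self[OF d(1,2) \<theta>] by (auto simp: d'_def)
      have d'\<rho>: "d' powr (1 / \<theta> ^ k) \<le> \<rho>" using d by (simp add: d'_def powr_powr)
      have \<rho>: "0 < \<rho>" using d'\<rho> d' by (smt (verit) powr_gt_zero)
      let ?A = "X \<inter> cball y d"
      have bdd: "bounded ?A" by (auto intro: bounded_subset[OF bounded_cball])
      have "real (card (grid \<rho> ` ?A)) \<le> real (card (grid (d' / 2) ` ?A)) * (C * (d' / \<rho>) powr \<beta> * \<rho> powr (-\<eta>))"
      proof (rule card_grid_split[OF \<rho> _ bdd])
        fix z assume z: "z \<in> ?A"
        have "card (grid \<rho> ` (?A \<inter> cball z (2 * (d' / 2)))) \<le> card (grid \<rho> ` (X \<inter> cball z d'))"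
          using \<rho> by (intro card_grid_mono) (auto intro: bounded_subset[OF bounded_cball])
        then show "real (card (grid \<rho> ` (?A \<inter> cball z (2 * (d' / 2))))) \<le> C * (d' / \<rho>) powr \<beta> * \<rho> powr (-\<eta>)"
          using C(2)[OF d'(1,2) d'\<rho> d'(3), of z] z by auto
      qed (use d' in simp)
      also have "\<dots> \<le> C0 * (d / d') powr \<beta> * 100 * (C * (d' / \<rho>) powr \<beta> * \<rho> powr (-\<eta>))"
      proof (rule mult_right_mono)
        have "real (card (grid (d' / 2) ` ?A)) \<le> real (card (grid d' ` ?A)) * 100"
          using d' bdd by (intro card_grid_half) auto
        also have "\<dots> \<le> C0 * (d / d') powr \<beta> * 100"
          using C0(2)[OF d(1,2,5)] by (simp add: d'_def)
        finally show "real (card (grid (d' / 2) ` ?A)) \<le> C0 * (d / d') powr \<beta> * 100" .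
      qed (use C(1) in simp)
      also have "\<dots> = 100 * C0 * C * (((d / d') powr \<beta> * (d' / \<rho>) powr \<beta>) * \<rho> powr (-\<eta>))" by simp
      also have "(d / d') powr \<beta> * (d' / \<rho>) powr \<beta> = (d / \<rho>) powr \<beta>"
        using d d' \<rho> by (simp flip: powr_mult)
      also have "100 * C0 * C * ((d / \<rho>) powr \<beta> * \<rho> powr (-\<eta>))
          \<le> max 16 (100 * C0 * C) * ((d / \<rho>) powr \<beta> * \<rho> powr (-\<eta>))"
        by (intro mult_right_mono) auto
      finally show ?thesis by (simp add: mult.assoc)
    qed
    moreover have "0 < max 16 (100 * C0 * C)" by simp
    ultimately show ?case by blast
  qed
qed

text \<open>When \<open>\<theta> ^ k < \<theta>0\<close>, a chain of \<open>k\<close> steps reaches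
  \<open>R powr (1 / \<theta>0)\<close> from \<open>R\<close>. In terms of \<open>R / \<rho>\<close>
  the loss \<open>\<rho> powr (-\<eta>)\<close> has exponent
  \<open>\<eta> / (1 - \<theta>0)\<close>. It vanishes as \<theta> tends to 1, which is all the
  monotonicity that the limit requires.\<close>

lemma assouad_spectrum_almost_increasing:
  fixes X :: "(real \<times> real) set"
  assumes \<theta>: "0 < \<theta>" "\<theta> < 1" and \<theta>0: "0 < \<theta>0" "\<theta>0 < 1"
  shows "assouad_spectrum \<theta>0 X \<le> assouad_spectrum \<theta> X + 2 * (1 / \<theta> - 1) / (1 - \<theta>0)"
proof (rule field_le_epsilon)
  fix e :: real assume "0 < e"
  define \<eta> where "\<eta> = 2 * (1 / \<theta> - 1)"
  define \<beta> where "\<beta> = assouad_spectrum \<theta> X + e"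
  have \<eta>: "0 \<le> \<eta>" using \<theta> by (simp add: \<eta>_def field_simps)
  have "0 \<le> \<beta>" using assouad_spectrum_plane_bounds[OF \<theta>, of X] \<open>0 < e\<close> by (simp add: \<beta>_def)
  obtain k where k: "\<theta> ^ k < \<theta>0" using real_arch_pow_inv[OF \<theta>0(1) \<theta>(2)] by blast
  have "assouad_spectrum \<theta> X < \<beta>" using \<open>0 < e\<close> by (simp add: \<beta>_def)
  then obtain C where C: "0 < C" "\<And>d \<rho> y. 0 < d \<Longrightarrow> d < 1 \<Longrightarrow> d powr (1 / \<theta> ^ k) \<le> \<rho> \<Longrightarrow> \<rho> \<le> d \<Longrightarrow> y \<in> X \<Longrightarrow>
      real (card (grid \<rho> ` (X \<inter> cball y d))) \<le> C * (d / \<rho>) powr \<beta> * \<rho> powr (-\<eta>)"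
    using grid_bound_chain[OF \<theta>, of X \<beta> k] unfolding \<eta>_def mult_minus_left by blast
  have "assouad_spectrum \<theta>0 X \<le> \<beta> + \<eta> / (1 - \<theta>0)"
  proof (rule assouad_spectrum_le(2)[OF _ C(1)])
    fix R :: real and x assume R: "0 < R" "R < 1" "x \<in> X"
    define \<rho> where "\<rho> = R powr (1 / \<theta>0)"
    have \<rho>: "0 < \<rho>" "\<rho> \<le> R" using R powr_inverse_le_self[OF R(1,2) \<theta>0] by (auto simp: \<rho>_def)
    have "1 / \<theta>0 \<le> 1 / \<theta> ^ k" using k \<theta> \<theta>0 by (intro divide_left_mono) auto
    then have le: "R powr (1 / \<theta> ^ k) \<le> \<rho>" unfolding \<rho>_def using R by (intro powr_mono') auto
    have "covering_number \<rho> (X \<inter> cball x R) \<le> card (grid \<rho> ` (X \<inter> cball x R))"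
      using \<rho> by (intro covering_number_le_grid) (auto intro: bounded_subset[OF bounded_cball])
    then have "real (covering_number \<rho> (X \<inter> cball x R)) \<le> C * (R / \<rho>) powr \<beta> * \<rho> powr (-\<eta>)"
      using C(2)[OF R(1,2) le \<rho>(2) R(3)] by linarith
    also have "\<rho> powr (-\<eta>) = (R / \<rho>) powr (\<eta> / (1 - \<theta>0))"
    proof -
      have "R / \<rho> = R powr 1 / R powr (1 / \<theta>0)" using R by (simp add: \<rho>_def)
      also have "\<dots> = R powr (1 - 1 / \<theta>0)" by (simp only: powr_diff[symmetric])
      finally have "(R / \<rho>) powr (\<eta> / (1 - \<theta>0)) = R powr ((1 - 1 / \<theta>0) * (\<eta> / (1 - \<theta>0)))" by (simp add: powr_powr)
      also have "(1 - 1 / \<theta>0) * (\<eta> / (1 - \<theta>0)) = 1 / \<theta>0 * -\<eta>" using \<theta>0 by (simp add: divide_simps) (simp add: algebra_simps)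
      finally show ?thesis by (simp add: \<rho>_def powr_powr)
    qed
    finally show "real (covering_number \<rho> (X \<inter> cball x R)) \<le> C * (R / \<rho>) powr (\<beta> + \<eta> / (1 - \<theta>0))"
      by (simp add: powr_add mult.assoc)
  qed (use \<open>0 \<le> \<beta>\<close> \<eta> \<theta>0 in simp)
  then show "assouad_spectrum \<theta>0 X \<le> assouad_spectrum \<theta> X + 2 * (1 / \<theta> - 1) / (1 - \<theta>0) + e"
    by (simp add: \<beta>_def \<eta>_def)
qed

text \<open>Almost-monotonicity forces convergence to the supremum over all \<theta> in (0,1). Since
  \<open>Lim\<close> is a definite description, convergence has to be proved before
  \<open>quasi_assouad_dim\<close> can be evaluated.\<close>

lemma assouad_spectrum_le_quasi_assouad_dim:
  fixes X :: "(real \<times> real) set"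
  assumes \<theta>0: "0 < \<theta>0" "\<theta>0 < 1"
  shows "assouad_spectrum \<theta>0 X \<le> quasi_assouad_dim X"
proof -
  define S where "S = Sup ((\<lambda>\<theta>. assouad_spectrum \<theta> X) ` {0<..<1})"
  have bdd: "bdd_above ((\<lambda>\<theta>. assouad_spectrum \<theta> X) ` {0<..<1})"
    using assouad_spectrum_plane_bounds[of _ X] by (intro bdd_aboveI[of _ 2]) auto
  have le_S: "assouad_spectrum \<theta> X \<le> S" if "0 < \<theta>" "\<theta> < 1" for \<theta>
    unfolding S_def using bdd that by (intro cSup_upper) auto
  have ev: "\<forall>\<^sub>F \<theta> in at_left (1::real). 0 < \<theta> \<and> \<theta> < 1"
    by (rule eventually_at_leftI[of 0]) auto
  have "((\<lambda>\<theta>. assouad_spectrum \<theta> X) \<longlongrightarrow> S) (at_left 1)"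
  proof (rule order_tendstoI)
    fix c assume "c < S"
    then obtain \<theta>1 where \<theta>1: "0 < \<theta>1" "\<theta>1 < 1" "c < assouad_spectrum \<theta>1 X"
      unfolding S_def using bdd less_cSup_iff[of "(\<lambda>\<theta>. assouad_spectrum \<theta> X) ` {0<..<1}"] by auto
    have "((\<lambda>\<theta>. 2 * (1 / \<theta> - 1) / (1 - \<theta>1)) \<longlongrightarrow> 2 * (1 / 1 - 1) / (1 - \<theta>1)) (at_left 1)"
      using \<theta>1 by (intro tendsto_intros) auto
    then have "\<forall>\<^sub>F \<theta> in at_left 1. 2 * (1 / \<theta> - 1) / (1 - \<theta>1) < assouad_spectrum \<theta>1 X - c"
      using \<theta>1 by (intro order_tendstoD(2)) auto
    then show "\<forall>\<^sub>F \<theta> in at_left 1. c < assouad_spectrum \<theta> X"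
      using ev
    proof eventually_elim
      case (elim \<theta>)
      then show ?case using assouad_spectrum_almost_increasing[of \<theta> \<theta>1 X] \<theta>1 by linarith
    qed
  next
    fix c assume "S < c"
    show "\<forall>\<^sub>F \<theta> in at_left 1. assouad_spectrum \<theta> X < c"
      using ev
    proof eventually_elim
      case (elim \<theta>)
      then show ?case using le_S[of \<theta>] \<open>S < c\<close> by simp
    qed
  qed
  then have "quasi_assouad_dim X = S"
    unfolding quasi_assouad_dim_def by (intro tendsto_Lim) auto
  then show ?thesis using le_S[OF \<theta>0] by simp
qed

text \<open>For \<theta> close to 1 a chain of fixed length covers all radii
  \<open>d \<le> \<rho> powr e\<close>. A larger radius is treated by splitting all of
  \<open>X\<close> into cells of size about \<open>\<rho> powr e\<close>; a small \<open>e\<close>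
  makes their number a small power of \<open>1 / \<rho>\<close>.\<close>

lemma grid_bound_all_scales:
  fixes X :: "(real \<times> real) set"
  assumes X: "bounded X" and s: "quasi_assouad_dim X \<le> s" and "0 < \<eta>"
  obtains C where "0 < C" "\<And>\<rho> d y. 0 < \<rho> \<Longrightarrow> \<rho> < 1 \<Longrightarrow> \<rho> \<le> d \<Longrightarrow> y \<in> X \<Longrightarrow>
      real (card (grid \<rho> ` (X \<inter> cball y d))) \<le> C * \<rho> powr (-\<eta>) * (d / \<rho>) powr s"
proof -
  \<comment> \<open>Chosen so that the loss exponent \<open>2 * (1 / \<theta> - 1)\<close> of the
    chain is \<open>\<eta> / 4\<close>.\<close>
  define \<theta> where "\<theta> = 1 / (1 + \<eta> / 8)"
  have \<theta>: "0 < \<theta>" "\<theta> < 1" using \<open>0 < \<eta>\<close> by (auto simp: \<theta>_def field_simps)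
  have \<theta>\<eta>: "2 * (1 / \<theta> - 1) = \<eta> / 4" using \<open>0 < \<eta>\<close> by (simp add: \<theta>_def)
  have le_s: "assouad_spectrum \<theta> X \<le> s" using assouad_spectrum_le_quasi_assouad_dim[OF \<theta>, of X] s by simp
  then have "0 \<le> s" using assouad_spectrum_plane_bounds[OF \<theta>, of X] by simp
  \<comment> \<open>\<open>e < 1\<close> keeps \<open>\<rho> powr e\<close> above
    \<open>\<rho>\<close>, and \<open>e \<le> \<eta> / 8\<close> makes the number of cells of that
    size, at most a multiple of \<open>\<rho> powr (- 2 * e)\<close>, affordable.\<close>
  define e where "e = min (\<eta> / 8) (1 / 2)"
  have e: "0 < e" "e < 1" "e \<le> \<eta> / 8" using \<open>0 < \<eta>\<close> by (auto simp: e_def)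
  obtain k where k: "\<theta> ^ k < e" using real_arch_pow_inv[OF e(1) \<theta>(2)] by blast
  have "assouad_spectrum \<theta> X < s + \<eta> / 4" using le_s \<open>0 < \<eta>\<close> by simp
  from grid_bound_chain[OF \<theta> this, of k]
  obtain C where C: "0 < C" "\<And>d \<rho> y. 0 < d \<Longrightarrow> d < 1 \<Longrightarrow> d powr (1 / \<theta> ^ k) \<le> \<rho> \<Longrightarrow> \<rho> \<le> d \<Longrightarrow> y \<in> X \<Longrightarrow>
      real (card (grid \<rho> ` (X \<inter> cball y d))) \<le> C * (d / \<rho>) powr (s + \<eta> / 4) * \<rho> powr (- (\<eta> / 4))"
    unfolding mult_minus_left \<theta>\<eta> by blast
  have small: "real (card (grid \<rho> ` (X \<inter> cball y d))) \<le> C * \<rho> powr (- (\<eta> / 2)) * (d / \<rho>) powr s"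
    if "0 < \<rho>" "\<rho> < 1" "\<rho> \<le> d" "d \<le> \<rho> powr e" "y \<in> X" for \<rho> d y
  proof -
    have d: "0 < d" "d < 1"
      using that e powr01_less_one[of \<rho> e] by auto
    have "d \<le> \<rho> powr (\<theta> ^ k)" using that k powr_mono'[of "\<theta> ^ k" e \<rho>] by simp
    then have "d powr (1 / \<theta> ^ k) \<le> (\<rho> powr (\<theta> ^ k)) powr (1 / \<theta> ^ k)"
      using d \<theta> by (intro powr_mono2) auto
    also have "\<dots> = \<rho>" using that \<theta> by (simp add: powr_powr)
    finally have "d powr (1 / \<theta> ^ k) \<le> \<rho>" .
    from C(2)[OF d this that(3,5)]
    have "real (card (grid \<rho> ` (X \<inter> cball y d))) \<le> C * (d / \<rho>) powr (s + \<eta> / 4) * \<rho> powr (- (\<eta> / 4))" .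
    also have "\<dots> = C * (d / \<rho>) powr s * \<rho> powr (- (\<eta> / 4)) * (d / \<rho>) powr (\<eta> / 4)" by (simp add: powr_add)
    \<comment> \<open>As \<open>d < 1\<close>, the excess \<open>\<eta> / 4\<close> in the exponent
      costs at most one further factor \<open>\<rho> powr (- (\<eta> / 4))\<close>.\<close>
    also have "\<dots> \<le> C * (d / \<rho>) powr s * \<rho> powr (- (\<eta> / 4)) * (1 / \<rho>) powr (\<eta> / 4)"
      using that d \<open>0 < \<eta>\<close> C(1) by (intro powr_mono2 divide_right_mono mult_left_mono) auto
    also have "(1 / \<rho>) powr (\<eta> / 4) = \<rho> powr (- (\<eta> / 4))"
      using that by (simp add: powr_divide powr_minus_divide)
    also have "C * (d / \<rho>) powr s * \<rho> powr (- (\<eta> / 4)) * \<rho> powr (- (\<eta> / 4))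
        = C * (\<rho> powr (- (\<eta> / 4)) * \<rho> powr (- (\<eta> / 4))) * (d / \<rho>) powr s" by simp
    also have "\<rho> powr (- (\<eta> / 4)) * \<rho> powr (- (\<eta> / 4)) = \<rho> powr (- (\<eta> / 2))" by (simp flip: powr_add)
    finally show ?thesis .
  qed
  obtain D0 where "X \<subseteq> cball 0 D0" using X by (meson ball_subset_cball bounded_subset_ballD order_trans)
  define D where "D = max 1 D0"
  have D: "1 \<le> D" "X \<subseteq> cball 0 D" using \<open>X \<subseteq> cball 0 D0\<close> by (auto simp: D_def)
  define M where "M = max 1 (36 * D\<^sup>2)"
  show thesis
  proof (rule that[of "M * C"])
    show "0 < M * C" using C(1) by (simp add: M_def)
    fix \<rho> d :: real and y assume \<rho>: "0 < \<rho>" "\<rho> < 1" and "\<rho> \<le> d" "y \<in> X"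
    show "real (card (grid \<rho> ` (X \<inter> cball y d))) \<le> M * C * \<rho> powr (-\<eta>) * (d / \<rho>) powr s"
    proof (cases "d \<le> \<rho> powr e")
      case True
      have "real (card (grid \<rho> ` (X \<inter> cball y d))) \<le> 1 * C * \<rho> powr (- (\<eta> / 2)) * (d / \<rho>) powr s"
        using small[OF \<rho> \<open>\<rho> \<le> d\<close> True \<open>y \<in> X\<close>] by simp
      also have "\<dots> \<le> M * C * \<rho> powr (-\<eta>) * (d / \<rho>) powr s"
        using C(1) \<rho> \<open>0 < \<eta>\<close> by (intro mult_right_mono[of _ _ "(d / \<rho>) powr s"] mult_mono powr_mono') (auto simp: M_def)
      finally show ?thesis .
    next
      case False
      \<comment> \<open>The ball is now replaced by all of \<open>X\<close>, split into cells of
        side \<open>d0 / 2\<close>; since \<open>d0 \<le> d\<close> and \<open>0 \<le> s\<close>,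
        the radius \<open>d\<close> can replace \<open>d0\<close> in the resulting bound.\<close>
      define d0 where "d0 = \<rho> powr e"
      have d0: "\<rho> \<le> d0" "d0 < 1" "d0 \<le> d" "0 < d0"
        using False \<rho> e powr_mono'[of e 1 \<rho>] powr01_less_one[of \<rho> e] by (auto simp: d0_def)
      have "real (card (grid \<rho> ` X)) \<le> real (card (grid (d0 / 2) ` X)) * (C * \<rho> powr (- (\<eta> / 2)) * (d0 / \<rho>) powr s)"
        using small[OF \<rho> d0(1)] d0 \<rho> X by (intro card_grid_split) (auto simp: d0_def)
      also have "\<dots> \<le> M * \<rho> powr (- (\<eta> / 2)) * (C * \<rho> powr (- (\<eta> / 2)) * (d / \<rho>) powr s)"
      proof (rule mult_mono)
        have "real (card (grid (d0 / 2) ` X)) = real (card (grid (d0 / 2) ` (X \<inter> cball 0 D)))"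
          using D by (simp add: Int_absorb2)
        also have "\<dots> \<le> (2 * D / (d0 / 2) + 2)\<^sup>2" using d0 D by (intro card_grid_cball_Int) auto
        also have "\<dots> \<le> (6 * D / d0)\<^sup>2" using d0 D by (intro power_mono) (auto simp: field_simps)
        also have "\<dots> = 36 * D\<^sup>2 * \<rho> powr (- 2 * e)"
        proof -
          have "d0\<^sup>2 = \<rho> powr (2 * e)" by (simp add: d0_def power2_eq_square flip: powr_add)
          then show ?thesis by (simp add: power_divide power_mult_distrib powr_minus_divide)
        qed
        also have "\<dots> \<le> M * \<rho> powr (- (\<eta> / 2))"
          using \<rho> e by (intro mult_mono powr_mono') (auto simp: M_def)
        finally show "real (card (grid (d0 / 2) ` X)) \<le> M * \<rho> powr (- (\<eta> / 2))" .
        show "C * \<rho> powr (- (\<eta> / 2)) * (d0 / \<rho>) powr s \<le> C * \<rho> powr (- (\<eta> / 2)) * (d / \<rho>) powr s"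
          using d0 \<rho> \<open>0 \<le> s\<close> C(1) by (intro mult_left_mono powr_mono2 divide_right_mono) auto
      qed (use C(1) in \<open>auto simp: M_def\<close>)
      also have "M * \<rho> powr (- (\<eta> / 2)) * (C * \<rho> powr (- (\<eta> / 2)) * (d / \<rho>) powr s)
         = M * C * (\<rho> powr (- (\<eta> / 2)) * \<rho> powr (- (\<eta> / 2))) * (d / \<rho>) powr s" by simp
      also have "\<rho> powr (- (\<eta> / 2)) * \<rho> powr (- (\<eta> / 2)) = \<rho> powr (-\<eta>)" by (simp flip: powr_add)
      finally have "real (card (grid \<rho> ` X)) \<le> M * C * \<rho> powr (-\<eta>) * (d / \<rho>) powr s" .
      moreover have "card (grid \<rho> ` (X \<inter> cball y d)) \<le> card (grid \<rho> ` X)"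
        using \<rho> X by (intro card_grid_mono) auto
      ultimately show ?thesis by linarith
    qed
  qed
qed

section \<open>Homogeneous self-similar sets\<close>

text \<open>Trace a point of \<open>K\<close> back through \<open>n\<close> maps, replace the point
  reached by a point of \<open>L\<close>, and apply the same maps forwards. The result lies in
  \<open>L\<close> within \<open>r ^ n * D\<close> of the given point, and \<open>L\<close> is
  closed.\<close>

lemma invariant_subset_unique:
  fixes c :: "'i \<Rightarrow> 'a::euclidean_space"
  assumes r: "0 < r" "r < 1"
    and K: "K = (\<Union>i\<in>J. (\<lambda>x. r *\<^sub>R x + c i) ` K)" "compact K"
    and L: "L = (\<Union>i\<in>J. (\<lambda>x. r *\<^sub>R x + c i) ` L)" "compact L" "L \<noteq> {}"
  shows "K \<subseteq> L"
proof
  fix x assume "x \<in> K"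
  have "bounded (K \<union> L)" using K(2) L(2) compact_imp_bounded by blast
  then obtain D where D: "\<And>x y. x \<in> K \<union> L \<Longrightarrow> y \<in> K \<union> L \<Longrightarrow> dist x y \<le> D"
    by (meson bounded_two_points)
  have near: "\<exists>y\<in>L. dist x y \<le> r ^ n * D" if "x \<in> K" for n x
    using that
  proof (induction n arbitrary: x)
    case 0
    then show ?case using L(3) D by auto
  next
    case (Suc n)
    then obtain i x' where i: "i \<in> J" "x' \<in> K" "x = r *\<^sub>R x' + c i" using K(1) by blast
    obtain y where y: "y \<in> L" "dist x' y \<le> r ^ n * D" using Suc.IH[OF i(2)] by blast
    have "r *\<^sub>R y + c i \<in> L" using L(1) i(1) y(1) by blast
    moreover have "dist x (r *\<^sub>R y + c i) = r * dist x' y"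
      using r(1) by (simp add: i(3) dist_norm flip: scaleR_diff_right)
    then have "dist x (r *\<^sub>R y + c i) \<le> r ^ Suc n * D" using y(2) r(1) by simp
    ultimately show ?case by blast
  qed
  have "infdist x L \<le> r ^ n * D" for n
    using near[OF \<open>x \<in> K\<close>, of n] infdist_le order_trans by blast
  moreover have "(\<lambda>n. r ^ n * D) \<longlonglongrightarrow> 0 * D"
    using r by (intro tendsto_intros LIMSEQ_realpow_zero) auto
  ultimately have "infdist x L \<le> 0" by (intro LIMSEQ_le_const) auto
  then have "infdist x L = 0" using infdist_nonneg[of x L] by simp
  then show "x \<in> L" using L(2,3) in_closed_iff_infdist_zero compact_imp_closed by blast
qed

lemma closure_finite_UN:
  "finite J \<Longrightarrow> closure (\<Union>i\<in>J. A i) = (\<Union>i\<in>J. closure (A i))"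
  by (induction rule: finite_induct) auto

lemma homogeneous_self_similar_set_ex:
  fixes c :: "'i \<Rightarrow> 'a::euclidean_space"
  assumes r: "0 < r" "r < 1" and J: "finite J" "J \<noteq> {}"
  shows "\<exists>K. K \<noteq> {} \<and> compact K \<and> K = (\<Union>i\<in>J. (\<lambda>x. r *\<^sub>R x + c i) ` K)"
proof -
  \<comment> \<open>The closure of the forward orbit of the fixed point of one of the maps.\<close>
  define f where "f i x = r *\<^sub>R x + c i" for i x
  define F where "F A = (\<Union>i\<in>J. f i ` A)" for A
  obtain k where k: "k \<in> J" using J(2) by blast
  define z where "z = (1 / (1 - r)) *\<^sub>R c k"
  have "f k z = z"
  proof -
    have "c k = (1 - r) *\<^sub>R z" using r by (simp add: z_def)
    then show ?thesis by (simp add: f_def algebra_simps)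
  qed
  define O' where "O' = (\<Union>n. (F ^^ n) {z})"
  have FO: "F O' = O'"
  proof -
    have "F O' = (\<Union>n. (F ^^ Suc n) {z})" unfolding O'_def F_def by auto
    \<comment> \<open>As \<open>z\<close> is a fixed point, it reappears after one step, so leaving
      out the zeroth iterate does not change the orbit.\<close>
    moreover have "z \<in> (F ^^ Suc 0) {z}" using k \<open>f k z = z\<close> by (force simp: F_def)
    then have "O' = (\<Union>n. (F ^^ Suc n) {z})"
      unfolding O'_def by (auto simp del: funpow.simps) (metis funpow_0 not0_implies_Suc singletonD)
    ultimately show ?thesis by simp
  qed
  \<comment> \<open>Every map sends \<open>cball 0 D\<close> into itself because
    \<open>norm (c i) \<le> (1 - r) * D\<close>; the summand \<open>norm z\<close> puts the starting
    point into this ball.\<close>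
  define D where "D = Max ((\<lambda>i. norm (c i)) ` J) / (1 - r) + norm z"
  have cD: "norm (c i) \<le> (1 - r) * D" if "i \<in> J" for i
  proof -
    have "norm (c i) \<le> Max ((\<lambda>i. norm (c i)) ` J)" using J that by auto
    moreover have "(1 - r) * D = Max ((\<lambda>i. norm (c i)) ` J) + (1 - r) * norm z"
      using r by (simp add: D_def field_simps)
    ultimately show ?thesis using r by (smt (verit) mult_nonneg_nonneg norm_ge_zero)
  qed
  have "norm (c k) \<le> Max ((\<lambda>i. norm (c i)) ` J)" using J(1) k by (intro Max_ge) auto
  then have "0 \<le> Max ((\<lambda>i. norm (c i)) ` J)" using norm_ge_zero order_trans by blast
  then have "norm z \<le> D" using r by (simp add: D_def)
  have "(F ^^ n) {z} \<subseteq> cball 0 D" for n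
  proof (induction n)
    case 0
    then show ?case using \<open>norm z \<le> D\<close> by simp
  next
    case (Suc n)
    have "norm (f i x) \<le> D" if "i \<in> J" "norm x \<le> D" for i x
    proof -
      have "norm (f i x) \<le> r * norm x + norm (c i)"
        using norm_triangle_ineq[of "r *\<^sub>R x" "c i"] r by (simp add: f_def)
      also have "\<dots> \<le> r * D + (1 - r) * D" using that r cD by (intro add_mono mult_left_mono) auto
      finally show ?thesis by (simp add: algebra_simps)
    qed
    then show ?case using Suc by (fastforce simp: F_def)
  qed
  then have "O' \<subseteq> cball 0 D" by (auto simp: O'_def)
  then have "bounded O'" using bounded_cball bounded_subset by blast
  have "closure (f i ` A) = f i ` closure A" for i A
  proof -
    have eq: "f i ` B = (+) (c i) ` (*\<^sub>R) r ` B" for B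
      by (auto simp: f_def image_image add.commute)
    show ?thesis unfolding eq by (simp add: closure_translation closure_scaleR)
  qed
  moreover have "closure O' = closure (\<Union>i\<in>J. f i ` O')" using FO by (simp add: F_def)
  ultimately have "closure O' = (\<Union>i\<in>J. f i ` closure O')"
    using J(1) by (simp only: closure_finite_UN)
  moreover have "compact (closure O')" using \<open>bounded O'\<close> by (simp add: compact_closure)
  moreover have "z \<in> O'" unfolding O'_def by (intro UN_I[of 0]) auto
  then have "closure O' \<noteq> {}" by auto
  ultimately show ?thesis unfolding f_def by blast
qed

lemma homogeneous_self_similar_set_unique:
  fixes c :: "'i \<Rightarrow> 'a::euclidean_space"
  assumes "0 < r" "r < 1" "K \<noteq> {}" "compact K" "K = (\<Union>i\<in>J. (\<lambda>x. r *\<^sub>R x + c i) ` K)"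
  shows "self_similar_set J (\<lambda>i x. r *\<^sub>R x + c i) = K"
  unfolding self_similar_set_def
proof (rule the_equality)
  fix L assume "L \<noteq> {} \<and> compact L \<and> L = (\<Union>i\<in>J. (\<lambda>x. r *\<^sub>R x + c i) ` L)"
  then have L: "L \<noteq> {}" "compact L" "L = (\<Union>i\<in>J. (\<lambda>x. r *\<^sub>R x + c i) ` L)" by auto
  show "L = K"
  proof
    show "L \<subseteq> K" by (rule invariant_subset_unique[OF assms(1,2) L(3,2) assms(5,4,3)])
    show "K \<subseteq> L" by (rule invariant_subset_unique[OF assms(1,2,5,4) L(3,2,1)])
  qed
qed (intro conjI assms(3-5))

lemma self_similar_set_props:
  fixes c :: "'i \<Rightarrow> 'a::euclidean_space"
  assumes "0 < r" "r < 1" "finite J" "J \<noteq> {}"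
  defines "K \<equiv> self_similar_set J (\<lambda>i x. r *\<^sub>R x + c i)"
  shows "K \<noteq> {}" "compact K" "K = (\<Union>i\<in>J. (\<lambda>x. r *\<^sub>R x + c i) ` K)"
proof -
  obtain L where *: "L \<noteq> {} \<and> compact L \<and> L = (\<Union>i\<in>J. (\<lambda>x. r *\<^sub>R x + c i) ` L)"
    using homogeneous_self_similar_set_ex[OF assms(1-4), of c] by (rule exE)
  note L = conjunct1[OF *] conjunct1[OF conjunct2[OF *]] conjunct2[OF conjunct2[OF *]]
  have "K = L" unfolding K_def using assms(1,2) L by (rule homogeneous_self_similar_set_unique)
  show "K \<noteq> {}" "compact K" "K = (\<Union>i\<in>J. (\<lambda>x. r *\<^sub>R x + c i) ` K)"
    unfolding \<open>K = L\<close> by (rule L)+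
qed

section \<open>Projections of the planar set onto the line\<close>

definition proj :: "real \<Rightarrow> real \<times> real \<Rightarrow> real" where
  "proj t p = fst p + t * snd p"

text \<open>\<open>proj t\<close> intertwines the planar maps with the maps on the line, so the
  image of the planar set is non-empty, compact and invariant, and uniqueness identifies it.\<close>

lemma proj_self_similar_set:
  fixes a b :: "'i \<Rightarrow> real"
  assumes r: "0 < r" "r < 1" and J: "finite J" "J \<noteq> {}"
  shows "self_similar_set J (\<lambda>i x. r * x + a i + t * b i)
    = proj t ` self_similar_set J (\<lambda>i p. r *\<^sub>R p + (a i, b i))" (is "_ = proj t ` ?X")
proof -
  note X = self_similar_set_props[OF r J, of "\<lambda>i. (a i, b i)"]
  have "self_similar_set J (\<lambda>i x. r *\<^sub>R x + (a i + t * b i)) = proj t ` ?X"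
  proof (rule homogeneous_self_similar_set_unique)
    show "compact (proj t ` ?X)" unfolding proj_def
      by (intro compact_continuous_image X continuous_intros)
    have "proj t (r *\<^sub>R p + (a i, b i)) = r *\<^sub>R proj t p + (a i + t * b i)" for i p
      by (simp add: proj_def algebra_simps)
    then have "proj t ` (\<Union>i\<in>J. (\<lambda>p. r *\<^sub>R p + (a i, b i)) ` ?X) = (\<Union>i\<in>J. (\<lambda>x. r *\<^sub>R x + (a i + t * b i)) ` proj t ` ?X)"
      by (simp add: image_UN image_image)
    then show "proj t ` ?X = (\<Union>i\<in>J. (\<lambda>x. r *\<^sub>R x + (a i + t * b i)) ` proj t ` ?X)"
      by (simp only: X(3)[symmetric])
    show "proj t ` ?X \<noteq> {}" using X(1) by simp
  qed (rule r)+
  then show ?thesis by (simp add: add.assoc)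
qed

section \<open>Hausdorff measures\<close>

lemma hausdorff_premeasure_le:
  assumes "A \<subseteq> (\<Union>n. U n)" "\<And>n. bounded (U n)" "\<And>n. diameter (U n) \<le> \<delta>"
  shows "hausdorff_premeasure \<delta> d A \<le> (\<Sum>n. diam_pow d (U n))"
  unfolding hausdorff_premeasure_def using assms by (intro INF_lower) auto

lemma hausdorff_premeasure_le_finite:
  assumes "finite Q" "0 \<le> \<delta>" "A \<subseteq> (\<Union>q\<in>Q. U q)"
    and "\<And>q. q \<in> Q \<Longrightarrow> bounded (U q)" "\<And>q. q \<in> Q \<Longrightarrow> diameter (U q) \<le> \<delta>"
  shows "hausdorff_premeasure \<delta> d A \<le> (\<Sum>q\<in>Q. diam_pow d (U q))"
proof -
  obtain f where f: "bij_betw f {0..<card Q} Q" using ex_bij_betw_nat_finite[OF assms(1)] by blast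
  \<comment> \<open>Padding with empty sets is free, as they contribute 0 for every exponent, and
    admissible, as their diameter 0 is at most \<open>\<delta>\<close>.\<close>
  define V where "V n = (if n < card Q then U (f n) else {})" for n
  have fQ: "f n \<in> Q" if "n < card Q" for n using f that by (auto simp: bij_betw_def)
  have "hausdorff_premeasure \<delta> d A \<le> (\<Sum>n. diam_pow d (V n))"
  proof (rule hausdorff_premeasure_le)
    show "A \<subseteq> (\<Union>n. V n)"
    proof
      fix x assume "x \<in> A"
      then obtain q where q: "q \<in> Q" "x \<in> U q" using assms(3) by blast
      then obtain n where "n < card Q" "f n = q"
        using f by (metis atLeastLessThan_iff bij_betw_imp_surj_on imageE)
      then show "x \<in> (\<Union>n. V n)" using q by (auto simp: V_def)
    qed
  qed (use assms fQ in \<open>auto simp: V_def\<close>)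
  also have "\<dots> = (\<Sum>n\<in>{0..<card Q}. diam_pow d (V n))"
    by (rule suminf_finite) (auto simp: V_def diam_pow_def)
  also have "\<dots> = (\<Sum>n\<in>{0..<card Q}. diam_pow d (U (f n)))" by (intro sum.cong) (auto simp: V_def)
  also have "\<dots> = (\<Sum>q\<in>Q. diam_pow d (U q))" using f by (rule sum.reindex_bij_betw)
  finally show ?thesis .
qed

lemma hausdorff_premeasure_mono:
  assumes "A \<subseteq> B"
  shows "hausdorff_premeasure \<delta> d A \<le> hausdorff_premeasure \<delta> d B"
  unfolding hausdorff_premeasure_def using assms by (intro INF_superset_mono) auto

text \<open>Covers within \<open>e / 2 ^ Suc n\<close> of optimal are merged along the pairing of
  natural numbers. An infinite premeasure has to be treated apart, because only a finite one is
  strictly below itself plus a positive error.\<close>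

lemma hausdorff_premeasure_UN_le:
  fixes A :: "nat \<Rightarrow> 'a::metric_space set"
  shows "hausdorff_premeasure \<delta> d (\<Union>n. A n) \<le> (\<Sum>n. hausdorff_premeasure \<delta> d (A n))"
proof (cases "\<exists>n. hausdorff_premeasure \<delta> d (A n) = top")
  case True
  then obtain n where "hausdorff_premeasure \<delta> d (A n) = top" by blast
  then have "\<not> (\<Sum>n. hausdorff_premeasure \<delta> d (A n)) < top"
    using ennreal_suminf_lessD[of "\<lambda>n. hausdorff_premeasure \<delta> d (A n)" top n] by auto
  then show ?thesis by (simp add: not_less top_unique)
next
  case False
  show ?thesis
  proof (rule ennreal_le_epsilon)
    fix e :: real assume "0 < e"
    define \<epsilon> where "\<epsilon> n = ennreal (e * (1 / 2) ^ Suc n)" for n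
    have \<epsilon>_sum: "(\<Sum>n. \<epsilon> n) = ennreal e"
    proof -
      have "(\<lambda>n. e * (1 / 2) ^ Suc n) sums (e * 1)" by (rule sums_mult[OF power_half_series])
      then show ?thesis unfolding \<epsilon>_def using \<open>0 < e\<close> by (intro suminf_ennreal_eq) auto
    qed
    have \<epsilon>: "0 < \<epsilon> n" for n using \<open>0 < e\<close> by (simp add: \<epsilon>_def)
    have "\<exists>U. A n \<subseteq> (\<Union>m. U m) \<and> (\<forall>m. bounded (U m) \<and> diameter (U m) \<le> \<delta>) \<and>
        (\<Sum>m. diam_pow d (U m)) \<le> hausdorff_premeasure \<delta> d (A n) + \<epsilon> n" for n
    proof -
      have "hausdorff_premeasure \<delta> d (A n) < hausdorff_premeasure \<delta> d (A n) + \<epsilon> n"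
        using False \<epsilon>[of n] ennreal_add_left_cancel_less[of "hausdorff_premeasure \<delta> d (A n)" 0 "\<epsilon> n"] by simp
      then show ?thesis
        unfolding hausdorff_premeasure_def[of \<delta> d "A n"] INF_less_iff by (auto intro: less_imp_le)
    qed
    then obtain U where U: "\<And>n. A n \<subseteq> (\<Union>m. U n m)" "\<And>n m. bounded (U n m)" "\<And>n m. diameter (U n m) \<le> \<delta>"
      "\<And>n. (\<Sum>m. diam_pow d (U n m)) \<le> hausdorff_premeasure \<delta> d (A n) + \<epsilon> n" by metis
    define V where "V k = (case prod_decode k of (n, m) \<Rightarrow> U n m)" for k
    have "hausdorff_premeasure \<delta> d (\<Union>n. A n) \<le> (\<Sum>k. diam_pow d (V k))"
    proof (rule hausdorff_premeasure_le)
      have "U n m \<subseteq> (\<Union>k. V k)" for n m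
        using UN_upper[of "prod_encode (n, m)" UNIV V] by (simp add: V_def)
      then show "(\<Union>n. A n) \<subseteq> (\<Union>k. V k)" by (intro UN_least order_trans[OF U(1)])
    qed (auto simp: V_def U split: prod.split)
    also have "\<dots> = (\<Sum>k. (case prod_decode k of (n, m) \<Rightarrow> diam_pow d (U n m)))"
      by (auto simp: V_def intro!: suminf_cong split: prod.split)
    also have "\<dots> = (\<Sum>n. \<Sum>m. diam_pow d (U n m))"
      by (rule suminf_ennreal_2dimen) simp
    also have "\<dots> \<le> (\<Sum>n. hausdorff_premeasure \<delta> d (A n) + \<epsilon> n)" by (intro suminf_le U) auto
    also have "\<dots> = (\<Sum>n. hausdorff_premeasure \<delta> d (A n)) + (\<Sum>n. \<epsilon> n)"
      by (rule suminf_add[symmetric]) auto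
    also have "\<dots> = (\<Sum>n. hausdorff_premeasure \<delta> d (A n)) + ennreal e" by (simp only: \<epsilon>_sum)
    finally show "hausdorff_premeasure \<delta> d (\<Union>n. A n) \<le> (\<Sum>n. hausdorff_premeasure \<delta> d (A n)) + ennreal e" .
  qed
qed

lemma hausdorff_measure_eq_0_iff:
  "hausdorff_measure d A = 0 \<longleftrightarrow> (\<forall>\<delta>>0. hausdorff_premeasure \<delta> d A = 0)"
proof
  assume 0: "hausdorff_measure d A = 0"
  show "\<forall>\<delta>>0. hausdorff_premeasure \<delta> d A = 0"
  proof (intro allI impI)
    fix \<delta> :: real assume "0 < \<delta>"
    then have "hausdorff_premeasure \<delta> d A \<le> hausdorff_measure d A"
      unfolding hausdorff_measure_def by (intro SUP_upper) auto
    then show "hausdorff_premeasure \<delta> d A = 0" using 0 by simp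
  qed
next
  assume "\<forall>\<delta>>0. hausdorff_premeasure \<delta> d A = 0"
  then have "hausdorff_measure d A \<le> 0"
    unfolding hausdorff_measure_def by (intro SUP_least) auto
  then show "hausdorff_measure d A = 0" by simp
qed

lemma hausdorff_measure_null_mono:
  assumes "A \<subseteq> B" "hausdorff_measure d B = 0"
  shows "hausdorff_measure d A = 0"
  unfolding hausdorff_measure_eq_0_iff
proof (intro allI impI)
  fix \<delta> :: real assume "0 < \<delta>"
  then have "hausdorff_premeasure \<delta> d B = 0" using assms(2) by (simp add: hausdorff_measure_eq_0_iff)
  then show "hausdorff_premeasure \<delta> d A = 0" using hausdorff_premeasure_mono[OF assms(1), of \<delta> d] by simp
qed

lemma hausdorff_measure_null_UN:
  assumes "\<And>n::nat. hausdorff_measure d (A n) = 0"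
  shows "hausdorff_measure d (\<Union>n. A n) = 0"
  unfolding hausdorff_measure_eq_0_iff
proof (intro allI impI)
  fix \<delta> :: real assume "0 < \<delta>"
  then have "hausdorff_premeasure \<delta> d (A n) = 0" for n using assms by (simp add: hausdorff_measure_eq_0_iff)
  then show "hausdorff_premeasure \<delta> d (\<Union>n. A n) = 0" using hausdorff_premeasure_UN_le[of \<delta> d A] by simp
qed

text \<open>Borel--Cantelli: the upper limit of the sets lies in every tail union, whose premeasure
  is at most a tail of a convergent series. The threshold may depend on \<open>\<delta>\<close>,
  because covers by small sets are available only from some \<open>n\<close> on.\<close>

lemma hausdorff_measure_limsup_null:
  fixes E :: "nat \<Rightarrow> 'a::metric_space set"
  assumes g: "summable g" "\<And>n. 0 \<le> g n"
    and E: "\<And>\<delta>. 0 < \<delta> \<Longrightarrow> \<exists>k. \<forall>n\<ge>k. hausdorff_premeasure \<delta> d (E n) \<le> ennreal (g n)"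
  shows "hausdorff_measure d {x. \<forall>k. \<exists>n\<ge>k. x \<in> E n} = 0"
  unfolding hausdorff_measure_eq_0_iff
proof (intro allI impI)
  fix \<delta> :: real assume "0 < \<delta>"
  let ?L = "{x. \<forall>k. \<exists>n\<ge>k. x \<in> E n}"
  obtain k0 where k0: "\<And>n. n \<ge> k0 \<Longrightarrow> hausdorff_premeasure \<delta> d (E n) \<le> ennreal (g n)"
    using E[OF \<open>0 < \<delta>\<close>] by blast
  have le: "hausdorff_premeasure \<delta> d ?L \<le> ennreal (\<Sum>n. g (n + k))" if "k \<ge> k0" for k
  proof -
    have "\<exists>n. x \<in> E (n + k)" if "x \<in> ?L" for x
    proof -
      have "\<forall>k. \<exists>n\<ge>k. x \<in> E n" using that by (rule CollectD)
      then obtain n where "n \<ge> k" "x \<in> E n" by meson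
      then show ?thesis by (intro exI[of _ "n - k"]) simp
    qed
    then have "hausdorff_premeasure \<delta> d ?L \<le> hausdorff_premeasure \<delta> d (\<Union>n. E (n + k))"
      by (intro hausdorff_premeasure_mono) blast
    also have "\<dots> \<le> (\<Sum>n. hausdorff_premeasure \<delta> d (E (n + k)))" by (rule hausdorff_premeasure_UN_le)
    also have "\<dots> \<le> (\<Sum>n. ennreal (g (n + k)))" using that by (intro suminf_le k0) auto
    also have "\<dots> = ennreal (\<Sum>n. g (n + k))"
      using g by (intro suminf_ennreal2) (auto simp: summable_iff_shift)
    finally show ?thesis .
  qed
  have "(\<lambda>k. ennreal (\<Sum>n. g (n + k))) \<longlonglongrightarrow> ennreal 0"
    by (intro tendsto_ennrealI suminf_exist_split2 g)
  then have "hausdorff_premeasure \<delta> d ?L \<le> ennreal 0"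
    by (rule LIMSEQ_le_const) (use le in blast)
  then show "hausdorff_premeasure \<delta> d ?L = 0" by simp
qed

text \<open>A non-empty bounded set lies in the closed interval about any of its points whose length
  is twice the diameter, so a cover with diameter sum below \<open>e / 2\<close> gives a measurable
  superset of measure below \<open>e\<close>.\<close>

lemma hausdorff_measure_1_null_imp_negligible:
  fixes A :: "real set"
  assumes "hausdorff_measure 1 A = 0"
  shows "negligible A"
  unfolding negligible_outer
proof (intro allI impI)
  fix e :: real assume "0 < e"
  have "hausdorff_premeasure 1 1 A < ennreal (e / 2)"
    using assms \<open>0 < e\<close> by (simp add: hausdorff_measure_eq_0_iff)
  then obtain U where U: "A \<subseteq> (\<Union>n. U n)" "\<And>n. bounded (U n)" "(\<Sum>n. diam_pow 1 (U n)) < ennreal (e / 2)"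
    unfolding hausdorff_premeasure_def INF_less_iff by blast
  define V where "V n = (if U n = {} then {} else cball (SOME x. x \<in> U n) (diameter (U n)))" for n
  have UV: "U n \<subseteq> V n" for n
  proof
    fix x assume x: "x \<in> U n"
    then have "(SOME x. x \<in> U n) \<in> U n" by (metis someI)
    then show "x \<in> V n" using x diameter_bounded_bound[OF U(2)] by (auto simp: V_def)
  qed
  have V: "emeasure lebesgue (V n) \<le> 2 * diam_pow 1 (U n)" for n
    using diameter_ge_0[OF U(2)[of n]]
    by (auto simp: V_def diam_pow_def cball_eq_atLeastAtMost emeasure_lborel_Icc_eq ennreal_mult' simp flip: mult_2)
  let ?T = "\<Union>n. V n"
  have sets: "V n \<in> sets lebesgue" for n by (auto simp: V_def)
  have "emeasure lebesgue ?T \<le> (\<Sum>n. emeasure lebesgue (V n))"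
    using sets by (intro emeasure_subadditive_countably) auto
  also have "\<dots> \<le> (\<Sum>n. 2 * diam_pow 1 (U n))" by (intro suminf_le V) auto
  also have "\<dots> = 2 * (\<Sum>n. diam_pow 1 (U n))" by simp
  also have "\<dots> < 2 * ennreal (e / 2)" using U(3) by (intro ennreal_mult_strict_left_mono) auto
  also have "\<dots> = ennreal e" using \<open>0 < e\<close> by (simp flip: ennreal_numeral ennreal_mult)
  finally have lt: "emeasure lebesgue ?T < ennreal e" .
  then have T: "?T \<in> lmeasurable" using sets by (intro fmeasurableI) (auto simp: order_less_le_trans)
  have "measure lebesgue ?T < e"
    using lt \<open>0 < e\<close> by (simp add: emeasure_eq_measure2[OF T] ennreal_less_iff)
  moreover have "A \<subseteq> ?T" using U(1) UN_mono[OF subset_refl UV] by (rule order_trans)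
  ultimately show "\<exists>T. A \<subseteq> T \<and> T \<in> lmeasurable \<and> measure lebesgue T < e"
    using T by (intro exI[of _ ?T] conjI)
qed

text \<open>The dimension is an infimum, so exponents just above \<open>\<alpha>\<close> decide. The
  cap \<open>\<beta>\<close> restricts the hypothesis to exponents for which nullity will be
  known.\<close>

lemma hausdorff_dim_le:
  assumes "0 \<le> \<alpha>" "\<alpha> < \<beta>" "\<And>d. \<alpha> < d \<Longrightarrow> d < \<beta> \<Longrightarrow> hausdorff_measure d A = 0"
  shows "hausdorff_dim A \<le> ereal \<alpha>"
proof (rule ereal_le_epsilon2)
  fix e :: real assume "0 < e"
  define d where "d = \<alpha> + min e ((\<beta> - \<alpha>) / 2)"
  have d: "\<alpha> < d" "d < \<beta>" "d \<le> \<alpha> + e" using \<open>0 < e\<close> assms(2) by (auto simp: d_def min_def field_simps)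
  have "hausdorff_dim A \<le> ereal d"
    unfolding hausdorff_dim_def using assms d by (intro Inf_lower) auto
  then show "hausdorff_dim A \<le> ereal \<alpha> + ereal e" using d(3) by (simp add: order_trans)
qed

section \<open>Dyadic Frostman weights\<close>

text \<open>For \<open>L > 0\<close> this is the half-open interval from
  \<open>c + l * L / 2 ^ j\<close> to \<open>c + (l + 1) * L / 2 ^ j\<close>. Through the floor,
  nesting of levels becomes integer division by powers of 2.\<close>

definition dyadic :: "real \<Rightarrow> real \<Rightarrow> nat \<Rightarrow> int \<Rightarrow> real set" where
  "dyadic c L j l = {t. \<lfloor>2 ^ j * ((t - c) / L)\<rfloor> = l}"

lemma floor_dyadic_coarsen:
  fixes x :: real
  assumes "k \<le> j"
  shows "\<lfloor>2 ^ k * x\<rfloor> = \<lfloor>2 ^ j * x\<rfloor> div 2 ^ (j - k)"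
proof -
  have "(2::real) ^ j = 2 ^ k * 2 ^ (j - k)" using assms by (simp flip: power_add)
  then have "2 ^ k * x = 2 ^ j * x / real_of_int (2 ^ (j - k))" by simp
  then show ?thesis by (simp only: floor_divide_real_eq_div zero_le_power zero_le_numeral)
qed

lemma dyadic_nested:
  assumes "k \<le> j" "t \<in> dyadic c L j l" "t \<in> dyadic c L k i" "t' \<in> dyadic c L j l"
  shows "t' \<in> dyadic c L k i"
  using assms(2-4) unfolding dyadic_def mem_Collect_eq floor_dyadic_coarsen[OF assms(1)] by (simp only:)

lemma dyadic_children:
  "dyadic c L k i = dyadic c L (Suc k) (2 * i) \<union> dyadic c L (Suc k) (2 * i + 1)"
proof (rule set_eqI)
  fix t
  have "\<lfloor>2 ^ k * ((t - c) / L)\<rfloor> = \<lfloor>2 ^ Suc k * ((t - c) / L)\<rfloor> div 2"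
    using floor_dyadic_coarsen[of k "Suc k" "(t - c) / L"] by simp
  then show "t \<in> dyadic c L k i \<longleftrightarrow> t \<in> dyadic c L (Suc k) (2 * i) \<union> dyadic c L (Suc k) (2 * i + 1)"
    unfolding dyadic_def mem_Collect_eq Un_iff by presburger
qed

lemma dyadic_disjoint: "l \<noteq> l' \<Longrightarrow> dyadic c L j l \<inter> dyadic c L j l' = {}"
  unfolding dyadic_def by blast

lemma dyadic_subset_cball:
  assumes "0 < L" "t \<in> dyadic c L j l"
  shows "dyadic c L j l \<subseteq> cball t (L / 2 ^ j)"
proof
  fix t' assume "t' \<in> dyadic c L j l"
  then have "\<bar>2 ^ j * ((t - c) / L) - 2 ^ j * ((t' - c) / L)\<bar> \<le> 1"
    using assms(2) unfolding dyadic_def by simp linarith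
  also have "2 ^ j * ((t - c) / L) - 2 ^ j * ((t' - c) / L) = (t - t') * (2 ^ j / L)"
    using assms(1) by (simp add: field_simps)
  finally have "\<bar>t - t'\<bar> * (2 ^ j / L) \<le> 1" using assms(1) by (simp add: abs_mult)
  then show "t' \<in> cball t (L / 2 ^ j)" using assms(1) by (simp add: dist_real_def field_simps)
qed

lemma dyadic_diameter:
  assumes "0 < L"
  shows "bounded (dyadic c L j l)" "diameter (dyadic c L j l) \<le> L / 2 ^ j"
proof -
  have le: "dist x y \<le> L / 2 ^ j" if "x \<in> dyadic c L j l" "y \<in> dyadic c L j l" for x y
    using dyadic_subset_cball[OF assms that(1)] that(2) by auto
  then show "bounded (dyadic c L j l)" unfolding bounded_two_points by blast
  show "diameter (dyadic c L j l) \<le> L / 2 ^ j"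
    using assms le by (intro diameter_le) (auto simp: dist_norm)
qed

text \<open>A finite Frostman lemma: descending from level \<open>k + m\<close> to level \<open>k\<close>, the mass put on a cell is cut
  down to \<open>q\<close> whenever it is too large, and the cells where this happens last form an economical cover.\<close>
lemma dyadic_frostman:
  fixes q :: "nat \<Rightarrow> real"
  assumes q: "\<And>j. 0 < q j"
  shows "\<exists>A w Q. finite A \<and> A \<subseteq> E \<inter> dyadic c L k i \<and> (\<forall>t. 0 \<le> w t) \<and> finite Q
    \<and> E \<inter> dyadic c L k i \<subseteq> (\<Union>p\<in>Q. dyadic c L (fst p) (snd p))
    \<and> (\<Sum>p\<in>Q. q (fst p)) \<le> sum w A
    \<and> (\<forall>j l. k \<le> j \<and> j \<le> k + m \<longrightarrow> sum w (A \<inter> dyadic c L j l) \<le> q j)"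
proof (induction m arbitrary: k i)
  case 0
  show ?case
  proof (cases "E \<inter> dyadic c L k i = {}")
    case True
    then show ?thesis using q by (intro exI[of _ "{}"] exI[of _ "\<lambda>_. 0"]) (auto intro: less_imp_le)
  next
    case False
    then obtain t where "t \<in> E \<inter> dyadic c L k i" by blast
    moreover have "sum (\<lambda>_. q k) ({t} \<inter> dyadic c L j l) \<le> q k" for j l
      using q[of k] by (cases "t \<in> dyadic c L j l") auto
    ultimately show ?thesis using q
      by (intro exI[of _ "{t}"] exI[of _ "\<lambda>_. q k"] exI[of _ "{(k, i)}"]) (auto intro: less_imp_le)
  qed
next
  case (Suc m)
  obtain A0 w0 Q0 where A0: "finite A0" "A0 \<subseteq> E \<inter> dyadic c L (Suc k) (2 * i)" "\<And>t. 0 \<le> w0 t" "finite Q0"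
    "E \<inter> dyadic c L (Suc k) (2 * i) \<subseteq> (\<Union>p\<in>Q0. dyadic c L (fst p) (snd p))"
    "(\<Sum>p\<in>Q0. q (fst p)) \<le> sum w0 A0"
    "\<And>j l. Suc k \<le> j \<and> j \<le> Suc k + m \<Longrightarrow> sum w0 (A0 \<inter> dyadic c L j l) \<le> q j"
    using Suc[of "Suc k" "2 * i"] by blast
  obtain A1 w1 Q1 where A1: "finite A1" "A1 \<subseteq> E \<inter> dyadic c L (Suc k) (2 * i + 1)" "\<And>t. 0 \<le> w1 t" "finite Q1"
    "E \<inter> dyadic c L (Suc k) (2 * i + 1) \<subseteq> (\<Union>p\<in>Q1. dyadic c L (fst p) (snd p))"
    "(\<Sum>p\<in>Q1. q (fst p)) \<le> sum w1 A1"
    "\<And>j l. Suc k \<le> j \<and> j \<le> Suc k + m \<Longrightarrow> sum w1 (A1 \<inter> dyadic c L j l) \<le> q j"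
    using Suc[of "Suc k" "2 * i + 1"] by blast
  define A where "A = A0 \<union> A1"
  define w where "w t = (if t \<in> A0 then w0 t else w1 t)" for t
  have disj: "A0 \<inter> A1 = {}"
  proof -
    have "A0 \<inter> A1 \<subseteq> dyadic c L (Suc k) (2 * i) \<inter> dyadic c L (Suc k) (2 * i + 1)"
      using A0(2) A1(2) by (intro Int_mono) simp_all
    then show ?thesis using dyadic_disjoint[of "2 * i" "2 * i + 1" c L "Suc k"] by simp
  qed
  have finA: "finite A" using A0(1) A1(1) by (simp add: A_def)
  have A_sub: "A \<subseteq> E \<inter> dyadic c L k i"
    using A0(2) A1(2) unfolding A_def dyadic_children[of c L k i] by (simp add: le_supI1 le_supI2)
  have w: "0 \<le> w t" for t using A0(3) A1(3) by (simp add: w_def)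
  have split: "sum w (A \<inter> S) = sum w0 (A0 \<inter> S) + sum w1 (A1 \<inter> S)" for S
  proof -
    have "sum w (A \<inter> S) = sum w (A0 \<inter> S) + sum w (A1 \<inter> S)"
      unfolding A_def Int_Un_distrib2 using A0(1) A1(1) disj by (intro sum.union_disjoint) auto
    also have "sum w (A0 \<inter> S) = sum w0 (A0 \<inter> S)" by (intro sum.cong) (auto simp: w_def)
    also have "sum w (A1 \<inter> S) = sum w1 (A1 \<inter> S)" using disj by (intro sum.cong) (auto simp: w_def)
    finally show ?thesis .
  qed
  \<comment> \<open>A cell of a finer level lies in one of the two halves, so it cannot carry mass
    from both.\<close>
  have fine: "sum w (A \<inter> dyadic c L j l) \<le> q j" if "Suc k \<le> j" "j \<le> k + Suc m" for j l
  proof (cases "A0 \<inter> dyadic c L j l = {} \<or> A1 \<inter> dyadic c L j l = {}")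
    case True
    then show ?thesis using A0(7)[of j l] A1(7)[of j l] that q[of j] split[of "dyadic c L j l"] by auto
  next
    case False
    then obtain t0 t1 where t: "t0 \<in> A0" "t0 \<in> dyadic c L j l" "t1 \<in> A1" "t1 \<in> dyadic c L j l" by blast
    then have "t1 \<in> dyadic c L (Suc k) (2 * i)" using dyadic_nested[OF that(1)] A0(2) by blast
    moreover have "t1 \<in> dyadic c L (Suc k) (2 * i + 1)" using t(3) A1(2) by blast
    ultimately show ?thesis using dyadic_disjoint[of "2 * i" "2 * i + 1" c L "Suc k"] by simp blast
  qed
  have cover: "E \<inter> dyadic c L k i \<subseteq> (\<Union>p\<in>Q0 \<union> Q1. dyadic c L (fst p) (snd p))"
    using Un_mono[OF A0(5) A1(5)] unfolding dyadic_children[of c L k i] Int_Un_distrib UN_Un .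
  show ?case
  proof (cases "sum w A \<le> q k")
    case True
    have "(\<Sum>p\<in>Q0 \<union> Q1. q (fst p)) \<le> (\<Sum>p\<in>Q0. q (fst p)) + (\<Sum>p\<in>Q1. q (fst p))"
    proof -
      have "0 \<le> (\<Sum>p\<in>Q0 \<inter> Q1. q (fst p))" by (intro sum_nonneg less_imp_le q)
      then show ?thesis using sum.union_inter[OF A0(4) A1(4), of "\<lambda>p. q (fst p)"] by linarith
    qed
    also have "\<dots> \<le> sum w A" using A0(6) A1(6) split[of UNIV] by simp
    finally have sumQ: "(\<Sum>p\<in>Q0 \<union> Q1. q (fst p)) \<le> sum w A" .
    have "sum w (A \<inter> dyadic c L j l) \<le> q j" if "k \<le> j" "j \<le> k + Suc m" for j l
    proof (cases "j = k")
      case True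
      have "sum w (A \<inter> dyadic c L j l) \<le> sum w A" using finA w by (intro sum_mono2) auto
      then show ?thesis using \<open>sum w A \<le> q k\<close> True by simp
    next
      case False
      then show ?thesis using fine that by simp
    qed
    then show ?thesis using finA A_sub w A0(4) A1(4) cover sumQ
      by (intro exI[of _ A] exI[of _ w] exI[of _ "Q0 \<union> Q1"] conjI) auto
  next
    case False
    \<comment> \<open>After scaling the total mass down to \<open>q k\<close>, the single cell
      \<open>(k, i)\<close> is a cover of exactly that cost, and the bounds on finer cells persist
      because no weight has grown.\<close>
    define w' where "w' t = q k / sum w A * w t" for t
    have pos: "0 < sum w A" using False q[of k] by linarith
    have w': "0 \<le> w' t" "w' t \<le> w t" for t
    proof -
      show "0 \<le> w' t" using pos q[of k] w[of t] by (simp add: w'_def)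
      have "q k / sum w A * w t \<le> 1 * w t" using pos False w[of t] by (intro mult_right_mono) auto
      then show "w' t \<le> w t" by (simp add: w'_def)
    qed
    have "sum w' A = q k / sum w A * sum w A" by (simp add: w'_def sum_distrib_left)
    then have total: "sum w' A = q k" using pos by simp
    have "sum w' (A \<inter> dyadic c L j l) \<le> q j" if "k \<le> j" "j \<le> k + Suc m" for j l
    proof (cases "j = k")
      case True
      have "sum w' (A \<inter> dyadic c L j l) \<le> sum w' A" using finA w'(1) by (intro sum_mono2) auto
      then show ?thesis using total True by simp
    next
      case False
      have "sum w' (A \<inter> dyadic c L j l) \<le> sum w (A \<inter> dyadic c L j l)" by (intro sum_mono w'(2))
      then show ?thesis using fine[of j l] that False by simp
    qed
    then show ?thesis using finA A_sub w'(1) total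
      by (intro exI[of _ A] exI[of _ w'] exI[of _ "{(k, i)}"] conjI) auto
  qed
qed

section \<open>Energy and second moment estimates for weights\<close>

lemma sum_near_le:
  fixes w :: "real \<Rightarrow> real"
  assumes "0 < L" "finite A" "\<And>t. 0 \<le> w t" and wq: "\<And>l. sum w (A \<inter> dyadic c L j l) \<le> q"
  shows "sum w (A \<inter> cball t (L / 2 ^ j)) \<le> 3 * q"
proof -
  define l where "l = \<lfloor>2 ^ j * ((t - c) / L)\<rfloor>"
  let ?D = "\<lambda>l. A \<inter> dyadic c L j l"
  \<comment> \<open>Points at distance at most one cell length have indices differing by at most 1,
    which gives the three cells behind the factor 3.\<close>
  have "A \<inter> cball t (L / 2 ^ j) \<subseteq> ?D (l - 1) \<union> ?D l \<union> ?D (l + 1)"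
  proof
    fix t' assume t': "t' \<in> A \<inter> cball t (L / 2 ^ j)"
    then have "\<bar>t - t'\<bar> \<le> L / 2 ^ j" by (simp add: dist_real_def)
    then have "\<bar>t - t'\<bar> * (2 ^ j / L) \<le> 1" using assms(1) by (simp add: field_simps)
    moreover have "(t - t') * (2 ^ j / L) = 2 ^ j * ((t - c) / L) - 2 ^ j * ((t' - c) / L)"
      using assms(1) by (simp add: field_simps)
    then have "\<bar>t - t'\<bar> * (2 ^ j / L) = \<bar>2 ^ j * ((t - c) / L) - 2 ^ j * ((t' - c) / L)\<bar>"
      using assms(1) by (metis abs_mult abs_of_pos divide_pos_pos zero_less_numeral zero_less_power)
    ultimately have "\<bar>2 ^ j * ((t - c) / L) - 2 ^ j * ((t' - c) / L)\<bar> \<le> 1" by simp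
    then have "\<lfloor>2 ^ j * ((t' - c) / L)\<rfloor> \<in> {l - 1, l, l + 1}" unfolding l_def insert_iff by linarith
    then show "t' \<in> ?D (l - 1) \<union> ?D l \<union> ?D (l + 1)" using t' by (auto simp: dyadic_def)
  qed
  then have "sum w (A \<inter> cball t (L / 2 ^ j)) \<le> sum w (?D (l - 1) \<union> ?D l \<union> ?D (l + 1))"
    using assms by (intro sum_mono2) auto
  also have "\<dots> \<le> sum w (?D (l - 1)) + sum w (?D l) + sum w (?D (l + 1))"
  proof -
    have un: "sum w (S \<union> T) \<le> sum w S + sum w T" if "finite S" "finite T" for S T
      using sum.union_inter[OF that, of w] sum_nonneg[of "S \<inter> T" w] assms(3) by simp
    show ?thesis using un[of "?D (l - 1) \<union> ?D l" "?D (l + 1)"] un[of "?D (l - 1)" "?D l"] assms(2) by simp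
  qed
  also have "\<dots> \<le> 3 * q" using wq[of "l - 1"] wq[of l] wq[of "l + 1"] by simp
  finally show ?thesis .
qed

text \<open>Decompose by the distance to \<open>t\<close>: at level \<open>k\<close> a mass of at
  most \<open>3 * (L / 2 ^ k) powr \<alpha>\<close> meets a kernel of size
  \<open>(2 ^ Suc k / L) powr \<alpha>\<close>, a contribution of at most 6. As kernel and weight
  have the same exponent, all \<open>n + 1\<close> levels count equally. Truncating the kernel at
  \<open>L / 2 ^ n\<close> stops the sum there.\<close>

lemma riesz_potential_le:
  fixes w :: "real \<Rightarrow> real"
  assumes L: "0 < L" and \<alpha>: "0 \<le> \<alpha>" "\<alpha> \<le> 1" and A: "finite A" "A \<subseteq> cball t L" and w: "\<And>t. 0 \<le> w t"
    and wq: "\<And>j l. j \<le> n \<Longrightarrow> sum w (A \<inter> dyadic c L j l) \<le> (L / 2 ^ j) powr \<alpha>"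
  shows "(\<Sum>t'\<in>A. w t' * (1 / max \<bar>t - t'\<bar> (L / 2 ^ n)) powr \<alpha>) \<le> 6 * (real n + 1)"
proof -
  define v where "v k = (2 ^ Suc k / L) powr \<alpha>" for k :: nat
  have kernel: "(1 / max \<bar>t - t'\<bar> (L / 2 ^ n)) powr \<alpha> \<le> (\<Sum>k\<le>n. if t' \<in> cball t (L / 2 ^ k) then v k else 0)"
    if "t' \<in> A" for t'
  proof -
    \<comment> \<open>The finest level at which \<open>t'\<close> is still near \<open>t\<close>.
      Failure at the next level, or the truncation if \<open>k = n\<close>, bounds the truncated
      distance below by \<open>L / 2 ^ Suc k\<close>.\<close>
    define k where "k = Max {k. k \<le> n \<and> t' \<in> cball t (L / 2 ^ k)}"
    have "t' \<in> cball t (L / 2 ^ 0)" using that A(2) by auto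
    then have ne: "{k. k \<le> n \<and> t' \<in> cball t (L / 2 ^ k)} \<noteq> {}" by blast
    have fin: "finite {k. k \<le> n \<and> t' \<in> cball t (L / 2 ^ k)}" by simp
    have k: "k \<le> n" "t' \<in> cball t (L / 2 ^ k)" using Max_in[OF fin ne] by (auto simp: k_def)
    have "L / 2 ^ Suc k \<le> max \<bar>t - t'\<bar> (L / 2 ^ n)"
    proof (cases "k = n")
      case True
      then show ?thesis using L by (simp add: field_simps max_def)
    next
      case False
      have "t' \<notin> cball t (L / 2 ^ Suc k)"
      proof
        assume "t' \<in> cball t (L / 2 ^ Suc k)"
        then have "Suc k \<in> {k. k \<le> n \<and> t' \<in> cball t (L / 2 ^ k)}" using False k(1) by simp
        from Max_ge[OF fin this] have "Suc k \<le> k" by (simp only: k_def)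
        then show False by simp
      qed
      then show ?thesis by (simp add: dist_real_def)
    qed
    then have "1 / max \<bar>t - t'\<bar> (L / 2 ^ n) \<le> 1 / (L / 2 ^ Suc k)"
      using L by (intro divide_left_mono) (auto intro!: mult_pos_pos simp: less_max_iff_disj)
    then have "(1 / max \<bar>t - t'\<bar> (L / 2 ^ n)) powr \<alpha> \<le> v k"
      unfolding v_def using L \<alpha> by (intro powr_mono2) (auto simp: le_max_iff_disj)
    also have "\<dots> = (if t' \<in> cball t (L / 2 ^ k) then v k else 0)" using k by simp
    also have "\<dots> \<le> (\<Sum>k\<le>n. if t' \<in> cball t (L / 2 ^ k) then v k else 0)"
      using k(1) by (intro member_le_sum) (auto simp: v_def)
    finally show ?thesis .
  qed
  have "(\<Sum>t'\<in>A. w t' * (1 / max \<bar>t - t'\<bar> (L / 2 ^ n)) powr \<alpha>)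
      \<le> (\<Sum>t'\<in>A. w t' * (\<Sum>k\<le>n. if t' \<in> cball t (L / 2 ^ k) then v k else 0))"
    by (intro sum_mono mult_left_mono kernel w)
  also have "\<dots> = (\<Sum>k\<le>n. \<Sum>t'\<in>A. w t' * (if t' \<in> cball t (L / 2 ^ k) then v k else 0))"
    unfolding sum_distrib_left by (rule sum.swap)
  also have "\<dots> = (\<Sum>k\<le>n. v k * sum w (A \<inter> cball t (L / 2 ^ k)))"
  proof (rule sum.cong[OF refl])
    fix k
    have "(\<Sum>t'\<in>A. w t' * (if t' \<in> cball t (L / 2 ^ k) then v k else 0))
        = (\<Sum>t'\<in>A. if t' \<in> cball t (L / 2 ^ k) then v k * w t' else 0)" by (intro sum.cong) auto
    also have "\<dots> = (\<Sum>t'\<in>A \<inter> cball t (L / 2 ^ k). v k * w t')" using A(1) by (simp only: sum.inter_restrict)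
    finally show "(\<Sum>t'\<in>A. w t' * (if t' \<in> cball t (L / 2 ^ k) then v k else 0)) = v k * sum w (A \<inter> cball t (L / 2 ^ k))"
      by (simp only: sum_distrib_left)
  qed
  also have "\<dots> \<le> (\<Sum>k\<le>n. 6)"
  proof (rule sum_mono)
    fix k assume "k \<in> {..n}"
    then have "sum w (A \<inter> cball t (L / 2 ^ k)) \<le> 3 * (L / 2 ^ k) powr \<alpha>"
      using sum_near_le[OF L A(1) w, where c = c and j = k] wq by simp
    then have "v k * sum w (A \<inter> cball t (L / 2 ^ k)) \<le> v k * (3 * (L / 2 ^ k) powr \<alpha>)"
      by (intro mult_left_mono) (auto simp: v_def)
    also have "\<dots> = 3 * (2 ^ Suc k / L * (L / 2 ^ k)) powr \<alpha>" using L by (subst powr_mult) (simp_all add: v_def)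
    also have "2 ^ Suc k / L * (L / 2 ^ k) = (2::real)" using L by simp
    also have "3 * 2 powr \<alpha> \<le> 3 * (2::real) powr 1" using \<alpha> by (intro mult_left_mono powr_mono) auto
    finally show "v k * sum w (A \<inter> cball t (L / 2 ^ k)) \<le> 6" by simp
  qed
  finally show ?thesis by (simp add: algebra_simps)
qed

text \<open>Let \<open>f g\<close> be the total weight of the sets \<open>P t\<close> containing
  \<open>g\<close>. Its sum over \<open>G\<close> is \<open>sum w A * m\<close>, the sum of its
  squares is the weighted overlap, and Cauchy--Schwarz is applied to \<open>f\<close> and the
  constant 1.\<close>

lemma weighted_incidence_cauchy_schwarz:
  fixes w :: "'t \<Rightarrow> real" and P :: "'t \<Rightarrow> 'g set"
  assumes "finite A" "finite G" "\<And>t. t \<in> A \<Longrightarrow> P t \<subseteq> G" "\<And>t. t \<in> A \<Longrightarrow> card (P t) = m"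
  shows "(sum w A * real m)\<^sup>2 \<le> real (card G) * (\<Sum>t\<in>A. \<Sum>t'\<in>A. w t * w t' * real (card (P t \<inter> P t')))"
proof -
  define f where "f g = (\<Sum>t\<in>A. w t * indicat_real (P t) g)" for g
  have card_eq: "(\<Sum>g\<in>G. indicat_real S g) = real (card S)" if "S \<subseteq> G" for S
  proof -
    have "(\<Sum>g\<in>G. indicat_real S g) = (\<Sum>g\<in>G \<inter> S. 1)"
      using assms(2) by (simp only: indicator_def of_bool_def sum.inter_restrict)
    then show ?thesis using that by (simp add: Int_absorb1)
  qed
  have "sum f G = (\<Sum>t\<in>A. \<Sum>g\<in>G. w t * indicat_real (P t) g)" unfolding f_def by (rule sum.swap)
  also have "\<dots> = (\<Sum>t\<in>A. w t * real m)"
    using assms(3,4) card_eq by (intro sum.cong) (auto simp flip: sum_distrib_left)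
  finally have f1: "sum f G = sum w A * real m" by (simp add: sum_distrib_right)
  have "(\<Sum>g\<in>G. (f g)\<^sup>2) = (\<Sum>g\<in>G. \<Sum>t\<in>A. \<Sum>t'\<in>A. w t * w t' * indicat_real (P t \<inter> P t') g)"
    unfolding f_def power2_eq_square sum_product by (intro sum.cong refl) (simp add: indicator_inter_arith mult_ac)
  also have "\<dots> = (\<Sum>t\<in>A. \<Sum>g\<in>G. \<Sum>t'\<in>A. w t * w t' * indicat_real (P t \<inter> P t') g)" by (rule sum.swap)
  also have "\<dots> = (\<Sum>t\<in>A. \<Sum>t'\<in>A. \<Sum>g\<in>G. w t * w t' * indicat_real (P t \<inter> P t') g)"
    by (intro sum.cong refl sum.swap)
  also have "\<dots> = (\<Sum>t\<in>A. \<Sum>t'\<in>A. w t * w t' * real (card (P t \<inter> P t')))"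
  proof (intro sum.cong refl)
    fix t t' assume "t \<in> A"
    then have "P t \<inter> P t' \<subseteq> G" using assms(3) by blast
    then show "(\<Sum>g\<in>G. w t * w t' * indicat_real (P t \<inter> P t') g) = w t * w t' * real (card (P t \<inter> P t'))"
      using card_eq by (simp flip: sum_distrib_left)
  qed
  finally have f2: "(\<Sum>g\<in>G. (f g)\<^sup>2) = (\<Sum>t\<in>A. \<Sum>t'\<in>A. w t * w t' * real (card (P t \<inter> P t')))" .
  have "(\<Sum>g\<in>G. 1 * f g)\<^sup>2 \<le> (\<Sum>g\<in>G. 1\<^sup>2) * (\<Sum>g\<in>G. (f g)\<^sup>2)" by (rule Cauchy_Schwarz_ineq_sum)
  then show ?thesis by (simp add: f1 f2)
qed

text \<open>Integrating the overlaps against a Frostman weight bounds its mass, hence the content of \<open>E\<close>.\<close>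
lemma dyadic_cover_of_incidences:
  fixes P :: "real \<Rightarrow> 'g set"
  assumes L: "0 < L" and \<alpha>: "0 \<le> \<alpha>" "\<alpha> \<le> 1" and E: "E \<subseteq> dyadic c L 0 0" and G: "finite G"
    and P: "\<And>t. t \<in> E \<Longrightarrow> P t \<subseteq> G" "\<And>t. t \<in> E \<Longrightarrow> card (P t) = m" and m: "1 \<le> m" and B: "0 \<le> B"
    and overlap: "\<And>t t'. t \<in> E \<Longrightarrow> t' \<in> E \<Longrightarrow> real (card (P t \<inter> P t')) \<le> B / max \<bar>t - t'\<bar> (L / 2 ^ n)"
  shows "\<exists>Q. finite Q \<and> E \<subseteq> (\<Union>p\<in>Q. dyadic c L (fst p) (snd p))
    \<and> (\<Sum>p\<in>Q. (L / 2 ^ fst p) powr \<alpha>) \<le> real (card G) * real m powr (- 1 - \<alpha>) * B powr \<alpha> * (6 * (real n + 1))"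
proof -
  have "0 < (L / 2 ^ j) powr \<alpha>" for j :: nat using L by simp
  from dyadic_frostman[of "\<lambda>j. (L / 2 ^ j) powr \<alpha>", OF this, of E c L 0 0 n]
  obtain A w Q where A: "finite A" "A \<subseteq> E \<inter> dyadic c L 0 0" and w: "\<And>t. 0 \<le> w t" and Q: "finite Q"
    "E \<inter> dyadic c L 0 0 \<subseteq> (\<Union>p\<in>Q. dyadic c L (fst p) (snd p))"
    "(\<Sum>p\<in>Q. (L / 2 ^ fst p) powr \<alpha>) \<le> sum w A"
    and wq': "\<forall>j l. 0 \<le> j \<and> j \<le> 0 + n \<longrightarrow> sum w (A \<inter> dyadic c L j l) \<le> (L / 2 ^ j) powr \<alpha>"
    by blast
  then have wq: "sum w (A \<inter> dyadic c L j l) \<le> (L / 2 ^ j) powr \<alpha>" if "j \<le> n" for j l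
    using that by simp
  define W where "W = sum w A"
  have "0 \<le> W" unfolding W_def by (intro sum_nonneg w)
  have inner: "(\<Sum>t'\<in>A. w t' * real (card (P t \<inter> P t'))) \<le> real m powr (1 - \<alpha>) * B powr \<alpha> * (6 * (real n + 1))"
    if "t \<in> A" for t
  proof -
    have ball: "A \<subseteq> cball t L"
      using A(2) that dyadic_subset_cball[OF L, of t c 0 0] by auto
    have "real (card (P t \<inter> P t')) \<le> real m powr (1 - \<alpha>) * B powr \<alpha> * (1 / max \<bar>t - t'\<bar> (L / 2 ^ n)) powr \<alpha>" if "t' \<in> A" for t'
    proof -
      define x where "x = real (card (P t \<inter> P t'))"
      have tE: "t \<in> E" "t' \<in> E" using that \<open>t \<in> A\<close> A(2) by auto
      have "card (P t \<inter> P t') \<le> card (P t)"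
        using P(1)[OF tE(1)] G by (intro card_mono) (auto dest: finite_subset)
      then have xm: "0 \<le> x" "x \<le> real m" using P(2)[OF tE(1)] by (auto simp: x_def)
      have xB: "x \<le> B * (1 / max \<bar>t - t'\<bar> (L / 2 ^ n))" using overlap[OF tE] by (simp add: x_def)
      \<comment> \<open>Interpolation: the trivial bound \<open>m\<close> is used with exponent
        \<open>1 - \<alpha>\<close> and the overlap bound with exponent \<open>\<alpha>\<close>, so
        that the kernel matches the Frostman exponent.\<close>
      have "x = x powr (1 - \<alpha>) * x powr \<alpha>" using xm by (simp flip: powr_add)
      also have "\<dots> \<le> real m powr (1 - \<alpha>) * (B * (1 / max \<bar>t - t'\<bar> (L / 2 ^ n))) powr \<alpha>"
        using xm xB \<alpha> by (intro mult_mono powr_mono2) auto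
      also have "\<dots> = real m powr (1 - \<alpha>) * B powr \<alpha> * (1 / max \<bar>t - t'\<bar> (L / 2 ^ n)) powr \<alpha>"
        using B L by (subst powr_mult) (auto simp: le_max_iff_disj)
      finally show ?thesis by (simp add: x_def)
    qed
    then have "(\<Sum>t'\<in>A. w t' * real (card (P t \<inter> P t')))
        \<le> (\<Sum>t'\<in>A. w t' * (real m powr (1 - \<alpha>) * B powr \<alpha> * (1 / max \<bar>t - t'\<bar> (L / 2 ^ n)) powr \<alpha>))"
      by (intro sum_mono mult_left_mono w) auto
    also have "\<dots> = real m powr (1 - \<alpha>) * B powr \<alpha> * (\<Sum>t'\<in>A. w t' * (1 / max \<bar>t - t'\<bar> (L / 2 ^ n)) powr \<alpha>)"
      by (simp add: sum_distrib_left mult_ac)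
    also have "\<dots> \<le> real m powr (1 - \<alpha>) * B powr \<alpha> * (6 * (real n + 1))"
      by (intro mult_left_mono riesz_potential_le[OF L \<alpha> A(1) ball w wq]) auto
    finally show ?thesis .
  qed
  have "(W * real m)\<^sup>2 \<le> real (card G) * (\<Sum>t\<in>A. \<Sum>t'\<in>A. w t * w t' * real (card (P t \<inter> P t')))"
    unfolding W_def using A(1) G P A(2) by (intro weighted_incidence_cauchy_schwarz) auto
  also have "(\<Sum>t\<in>A. \<Sum>t'\<in>A. w t * w t' * real (card (P t \<inter> P t')))
      = (\<Sum>t\<in>A. w t * (\<Sum>t'\<in>A. w t' * real (card (P t \<inter> P t'))))"
    by (simp add: sum_distrib_left mult_ac)
  also have "real (card G) * \<dots> \<le> real (card G) * (\<Sum>t\<in>A. w t * (real m powr (1 - \<alpha>) * B powr \<alpha> * (6 * (real n + 1))))"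
    by (intro mult_left_mono sum_mono inner w) auto
  also have "\<dots> = real (card G) * (W * (real m powr (1 - \<alpha>) * B powr \<alpha> * (6 * (real n + 1))))"
    by (simp only: W_def sum_distrib_right)
  finally have sq: "(W * real m)\<^sup>2 \<le> W * (real (card G) * real m powr (1 - \<alpha>) * B powr \<alpha> * (6 * (real n + 1)))"
    by (simp only: mult_ac)
  \<comment> \<open>The square on the left contains one factor \<open>W\<close> more than the
    right-hand side; cancelling the common one and dividing by the square of \<open>m\<close> leaves
    the exponent \<open>(1 - \<alpha>) - 2\<close>.\<close>
  have "W \<le> real (card G) * real m powr (- 1 - \<alpha>) * B powr \<alpha> * (6 * (real n + 1))"
  proof (cases "W = 0")
    case False
    then have "0 < W" using \<open>0 \<le> W\<close> by simp
    have "W * (W * (real m)\<^sup>2) \<le> W * (real (card G) * real m powr (1 - \<alpha>) * B powr \<alpha> * (6 * (real n + 1)))"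
      using sq by (simp only: power2_eq_square mult_ac)
    then have "W * (real m)\<^sup>2 \<le> real (card G) * real m powr (1 - \<alpha>) * B powr \<alpha> * (6 * (real n + 1))"
      using \<open>0 < W\<close> by (simp only: mult_le_cancel_left_pos)
    then have "W \<le> real (card G) * real m powr (1 - \<alpha>) * B powr \<alpha> * (6 * (real n + 1)) / (real m)\<^sup>2"
      using m by (simp add: pos_le_divide_eq)
    also have "\<dots> = real (card G) * (real m powr (1 - \<alpha>) / real m powr 2) * B powr \<alpha> * (6 * (real n + 1))"
      using m by (simp add: powr_realpow)
    also have "real m powr (1 - \<alpha>) / real m powr 2 = real m powr (- 1 - \<alpha>)"
      by (simp only: powr_diff[symmetric]) simp
    finally show ?thesis .
  qed simp
  then show ?thesis using Q E by (intro exI[of _ Q]) (auto simp: W_def Int_absorb2)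
qed

section \<open>Directions with rich strips\<close>

definition strip :: "real \<Rightarrow> real \<Rightarrow> real \<Rightarrow> (real \<times> real) set" where
  "strip t x R = {p. \<bar>proj t p - x\<bar> \<le> R}"

lemma proj_diff: "proj t p - proj t q = (fst p - fst q) + t * (snd p - snd q)"
  by (simp add: proj_def algebra_simps)

lemma proj_dist_le:
  assumes "\<bar>fst p - fst q\<bar> \<le> R" "\<bar>snd p - snd q\<bar> \<le> R"
  shows "\<bar>proj t p - proj t q\<bar> \<le> (1 + \<bar>t\<bar>) * R"
proof -
  have "\<bar>proj t p - proj t q\<bar> \<le> \<bar>fst p - fst q\<bar> + \<bar>t\<bar> * \<bar>snd p - snd q\<bar>"
    unfolding proj_diff by (metis abs_mult abs_triangle_ineq)
  also have "\<dots> \<le> R + \<bar>t\<bar> * R" using assms by (intro add_mono mult_left_mono) auto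
  finally show ?thesis by (simp add: algebra_simps)
qed

text \<open>Two strips of width comparable to \<open>R\<close> cross in a parallelogram of diameter
  at most a multiple of \<open>R / \<bar>t - t'\<bar>\<close>, so all common cells are met by
  \<open>X\<close> in one ball centred in \<open>X\<close>.\<close>

lemma card_grid_strip_Int_le:
  assumes R: "0 < R" and T: "1 \<le> T" "\<bar>t\<bar> \<le> T" "\<bar>t'\<bar> \<le> T" and ne: "t \<noteq> t'" and X: "bounded X"
    and b: "\<And>p. p \<in> X \<Longrightarrow> real (card (grid R ` (X \<inter> cball p (20 * T\<^sup>2 * R / \<bar>t - t'\<bar>)))) \<le> b" and "0 \<le> b"
  shows "real (card (grid R ` (X \<inter> strip t x R) \<inter> grid R ` (X \<inter> strip t' x' R))) \<le> b"
proof -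
  let ?\<phi> = "\<bar>t - t'\<bar>"
  let ?S = "grid R ` (X \<inter> strip t x R) \<inter> grid R ` (X \<inter> strip t' x' R)"
  have \<phi>: "0 < ?\<phi>" "?\<phi> \<le> 2 * T" using ne T by auto
  \<comment> \<open>The strips may meet a common cell at different points. Moving within a cell
    changes \<open>proj t'\<close> by at most \<open>(1 + T) * R\<close>, so the second strip is
    widened to contain the point found in the first.\<close>
  define Y where "Y = X \<inter> strip t x R \<inter> strip t' x' ((2 + T) * R)"
  have sub: "?S \<subseteq> grid R ` Y"
  proof
    fix g assume "g \<in> ?S"
    then obtain p p' where p: "p \<in> X" "p \<in> strip t x R" "g = grid R p"
      and p': "p' \<in> strip t' x' R" "g = grid R p'" by auto
    have "grid R p = grid R p'" using p(3) p'(2) by simp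
    then have "\<bar>proj t' p - proj t' p'\<bar> \<le> (1 + \<bar>t'\<bar>) * R"
      using R by (intro proj_dist_le grid_eq_imp_close)
    also have "\<dots> \<le> (1 + T) * R" using T R by (intro mult_right_mono) auto
    finally have "\<bar>proj t' p - x'\<bar> \<le> (1 + T) * R + R" using p'(1) unfolding strip_def by simp
    then have "p \<in> strip t' x' ((2 + T) * R)" by (simp add: strip_def algebra_simps)
    then show "g \<in> grid R ` Y" using p by (auto simp: Y_def)
  qed
  show ?thesis
  proof (cases "Y = {}")
    case True
    then have "?S = {}" using sub by simp
    then show ?thesis using \<open>0 \<le> b\<close> by simp
  next
    case False
    then obtain q where q: "q \<in> Y" by blast
    have near: "dist q p \<le> 20 * T\<^sup>2 * R / ?\<phi>" if "p \<in> Y" for p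
    proof -
      \<comment> \<open>Subtracting the two strip conditions eliminates \<open>u\<close> and bounds
        \<open>v\<close>; the first condition then bounds \<open>u\<close>. In units of
        \<open>z = T * R / \<bar>t - t'\<bar>\<close>, the bounds 8 for \<open>v\<close> and
        \<open>4 + 8 * T\<close> for \<open>u\<close> add up to at most
        \<open>20 * T\<close>.\<close>
      define u where "u = fst q - fst p"
      define v where "v = snd q - snd p"
      have 1: "\<bar>u + t * v\<bar> \<le> 2 * R"
        using q that unfolding Y_def strip_def u_def v_def proj_diff[symmetric] by simp linarith
      have "\<bar>proj t' q - proj t' p\<bar> \<le> 2 * ((2 + T) * R)"
        using q that unfolding Y_def strip_def by simp linarith
      then have 2: "\<bar>u + t' * v\<bar> \<le> 2 * ((2 + T) * R)" by (simp add: proj_diff u_def v_def)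
      have "\<bar>(t - t') * v\<bar> \<le> 2 * R + 2 * ((2 + T) * R)"
      proof -
        have "(t - t') * v = (u + t * v) - (u + t' * v)" by (simp add: algebra_simps)
        then show ?thesis using 1 2 by linarith
      qed
      also have "\<dots> = 6 * R + 2 * (T * R)" by (simp add: algebra_simps)
      also have "\<dots> \<le> 8 * (T * R)" using T(1) R by simp
      finally have "\<bar>v\<bar> * ?\<phi> \<le> 8 * (T * R)" by (simp add: abs_mult mult.commute)
      define z where "z = T * R / ?\<phi>"
      have "0 \<le> z" using T(1) R by (simp add: z_def)
      have v: "\<bar>v\<bar> \<le> 8 * z" using \<open>\<bar>v\<bar> * ?\<phi> \<le> 8 * (T * R)\<close> \<phi>(1) by (simp add: z_def pos_le_divide_eq)
      have "R * ?\<phi> \<le> R * (2 * T)" using \<phi>(2) R by (intro mult_left_mono) auto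
      then have z: "2 * R \<le> 4 * z" using \<phi>(1) by (simp add: z_def pos_le_divide_eq mult_ac)
      have "\<bar>u\<bar> \<le> 2 * R + \<bar>t\<bar> * \<bar>v\<bar>" using 1 by (simp flip: abs_mult)
      also have "\<dots> \<le> 4 * z + T * (8 * z)" using z T v by (intro add_mono[OF z] mult_mono) auto
      finally have u: "\<bar>u\<bar> \<le> 4 * z + T * (8 * z)" .
      have "dist q p \<le> \<bar>u\<bar> + \<bar>v\<bar>"
        unfolding dist_prod_def u_def v_def dist_real_def[symmetric] by (rule sqrt_sum_squares_le_sum) auto
      also have "\<dots> \<le> 12 * (1 * z) + 8 * (T * z)" using u v by simp
      also have "\<dots> \<le> 12 * (T * z) + 8 * (T * z)"
        using T(1) \<open>0 \<le> z\<close> by (intro add_right_mono mult_left_mono mult_right_mono) auto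
      also have "\<dots> = 20 * T\<^sup>2 * R / ?\<phi>" by (simp add: z_def power2_eq_square)
      finally show ?thesis .
    qed
    then have "Y \<subseteq> X \<inter> cball q (20 * T\<^sup>2 * R / ?\<phi>)" by (auto simp: Y_def)
    then have "?S \<subseteq> grid R ` (X \<inter> cball q (20 * T\<^sup>2 * R / ?\<phi>))" using sub by (meson image_mono order_trans)
    then have "card ?S \<le> card (grid R ` (X \<inter> cball q (20 * T\<^sup>2 * R / ?\<phi>)))"
      using R X by (intro card_mono finite_grid) auto
    moreover have "q \<in> X" using q by (simp add: Y_def)
    ultimately show ?thesis using b[of q] by linarith
  qed
qed

text \<open>With \<open>R = 1 / 2 ^ n\<close> the threshold is \<open>R powr (-v)\<close>. Only
  dyadic scales are considered: they suffice up to constants and leave a sequence of exceptional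
  sets.\<close>

definition rich_directions :: "(real \<times> real) set \<Rightarrow> real set \<Rightarrow> real \<Rightarrow> nat \<Rightarrow> real set" where
  "rich_directions X I v n =
    {t \<in> I. \<exists>x. (2 ^ n) powr v < real (card (grid (1 / 2 ^ n) ` (X \<inter> strip t x (1 / 2 ^ n))))}"

text \<open>Up to constants, with \<open>R = 1 / 2 ^ n\<close>, there are at most
  \<open>R powr (- s - \<eta>)\<close> cells, \<open>m\<close> is at least
  \<open>R powr (-v)\<close>, and overlaps are at most \<open>R powr (-\<eta>)\<close> over the
  truncated distance; here \<open>s \<le> 1\<close> turns a power \<open>s\<close> into a first
  power. As \<open>v * (1 + \<alpha>) \<ge> s + \<epsilon>\<close> and
  \<open>\<eta> = \<epsilon> / 4\<close>, the cost is at most \<open>R powr (\<epsilon> / 2)\<close>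
  times a factor linear in \<open>n\<close>.\<close>

lemma rich_directions_cover:
  assumes X: "bounded X" "quasi_assouad_dim X \<le> s" and s: "0 \<le> s" "s \<le> 1" and \<alpha>: "0 < \<alpha>" "\<alpha> \<le> 1"
    and "0 < \<epsilon>" and L: "0 < L" and I: "bounded I" "I \<subseteq> dyadic c L 0 0"
  obtains C where "0 < C" "\<forall>n\<ge>1. \<exists>Q. finite Q
    \<and> rich_directions X I (s / (1 + \<alpha>) + \<epsilon>) n \<subseteq> (\<Union>p\<in>Q. dyadic c L (fst p) (snd p))
    \<and> (\<Sum>p\<in>Q. (L / 2 ^ fst p) powr \<alpha>) \<le> C * (real (Suc n) * (2 powr (- \<epsilon> / 2)) ^ n)"
proof -
  define \<eta> where "\<eta> = \<epsilon> / 4"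
  have "0 < \<eta>" using \<open>0 < \<epsilon>\<close> by (simp add: \<eta>_def)
  define v where "v = s / (1 + \<alpha>) + \<epsilon>"
  have v: "0 \<le> v" "v * (1 + \<alpha>) = s + \<epsilon> * (1 + \<alpha>)" using s \<alpha> \<open>0 < \<epsilon>\<close> by (auto simp: v_def field_simps)
  obtain C0 where C0: "0 < C0" "\<And>\<rho> d y. 0 < \<rho> \<Longrightarrow> \<rho> < 1 \<Longrightarrow> \<rho> \<le> d \<Longrightarrow> y \<in> X \<Longrightarrow>
      real (card (grid \<rho> ` (X \<inter> cball y d))) \<le> C0 * \<rho> powr (-\<eta>) * (d / \<rho>) powr s"
    using grid_bound_all_scales[OF X \<open>0 < \<eta>\<close>] by blast
  obtain D0 where D0: "\<And>x y. x \<in> X \<Longrightarrow> y \<in> X \<Longrightarrow> dist x y \<le> D0" using X(1) unfolding bounded_two_points by blast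
  define D where "D = max 1 D0"
  have D: "1 \<le> D" "\<And>y. y \<in> X \<Longrightarrow> X \<subseteq> cball y D" using D0 by (auto simp: D_def le_max_iff_disj)
  obtain T0 where T0: "\<And>t. t \<in> I \<Longrightarrow> \<bar>t\<bar> \<le> T0" using I(1) by (auto simp: bounded_iff)
  define T where "T = max 1 T0"
  have T: "1 \<le> T" "\<And>t. t \<in> I \<Longrightarrow> \<bar>t\<bar> \<le> T" using T0 by (auto simp: T_def le_max_iff_disj)
  define C where "C = max 1 C0"
  have C: "1 \<le> C" "C0 \<le> C" by (auto simp: C_def)
  \<comment> \<open>One constant for both overlap estimates: \<open>20 * T\<^sup>2\<close> serves
    directions that are well separated, \<open>D * L\<close> those closer than
    \<open>L * R\<close>.\<close>
  define B0 where "B0 = C * (20 * T\<^sup>2 + D * L)"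
  have "1 * 1 \<le> T\<^sup>2" unfolding power2_eq_square using T(1) by (intro mult_mono) auto
  then have "1 * 1 \<le> B0" unfolding B0_def using C(1) D(1) L
    by (intro mult_mono) (auto intro: add_increasing2)
  then have B0: "1 \<le> B0" by simp
  show thesis
  proof (rule that[of "C * D * B0 * 6"])
    show "0 < C * D * B0 * 6" using C(1) D(1) B0 by simp
    show "\<forall>n\<ge>1. \<exists>Q. finite Q \<and> rich_directions X I (s / (1 + \<alpha>) + \<epsilon>) n \<subseteq> (\<Union>p\<in>Q. dyadic c L (fst p) (snd p))
        \<and> (\<Sum>p\<in>Q. (L / 2 ^ fst p) powr \<alpha>) \<le> C * D * B0 * 6 * (real (Suc n) * (2 powr (- \<epsilon> / 2)) ^ n)"
    proof (intro allI impI)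
      fix n :: nat assume "1 \<le> n"
      define R where "R = 1 / (2::real) ^ n"
      have "1 < (2::real) ^ n" using \<open>1 \<le> n\<close> by simp
      then have R: "0 < R" "R < 1" by (auto simp: R_def)
      define E where "E = rich_directions X I v n"
      define G where "G = grid R ` X"
      have finG: "finite G" unfolding G_def using R X by (intro finite_grid)
      have cardG: "real (card G) \<le> C * D * R powr (-\<eta>) * R powr (-s)"
      proof (cases "X = {}")
        case True
        then show ?thesis using C(1) D(1) by (simp add: G_def)
      next
        case False
        then obtain y where y: "y \<in> X" by blast
        have "real (card G) \<le> C0 * R powr (-\<eta>) * (D / R) powr s"
          using C0(2)[OF R _ y, of D] D(2)[OF y] R D(1) by (simp add: G_def Int_absorb2)
        also have "(D / R) powr s = D powr s * R powr (-s)"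
          using D(1) R by (simp add: powr_divide powr_minus_divide)
        also have "C0 * R powr (-\<eta>) * (D powr s * R powr (-s)) \<le> C * R powr (-\<eta>) * (D powr 1 * R powr (-s))"
          using C C0(1) D(1) s by (intro mult_mono powr_mono[of s 1 D]) auto
        finally show ?thesis using D(1) by (simp add: mult_ac)
      qed
      \<comment> \<open>Cauchy--Schwarz is applied to sets of equal size, so each rich strip is
        trimmed to exactly \<open>m\<close> of its cells.\<close>
      define m where "m = nat \<lceil>(1 / R) powr v\<rceil>"
      have big: "1 \<le> (1 / R) powr v" using R v by (intro ge_one_powr_ge_zero) auto
      have m: "1 \<le> m" "(1 / R) powr v \<le> real m" unfolding m_def using big by linarith+
      have "\<exists>P x. P \<subseteq> grid R ` (X \<inter> strip t x R) \<and> card P = m" if "t \<in> E" for t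
      proof -
        obtain x where "(2 ^ n) powr v < real (card (grid (1 / 2 ^ n) ` (X \<inter> strip t x (1 / 2 ^ n))))"
          using \<open>t \<in> E\<close> by (auto simp: E_def rich_directions_def)
        then have "(1 / R) powr v < real (card (grid R ` (X \<inter> strip t x R)))" by (simp add: R_def)
        then have "m \<le> card (grid R ` (X \<inter> strip t x R))" unfolding m_def by linarith
        then show ?thesis by (meson obtain_subset_with_card_n)
      qed
      then obtain P x where P: "\<And>t. t \<in> E \<Longrightarrow> P t \<subseteq> grid R ` (X \<inter> strip t (x t) R)" "\<And>t. t \<in> E \<Longrightarrow> card (P t) = m"
        by metis
      have PG: "P t \<subseteq> G" if "t \<in> E" for t using P(1)[OF that] by (auto simp: G_def)
      have EI: "E \<subseteq> I" by (auto simp: E_def rich_directions_def)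
      define B where "B = B0 * R powr (-\<eta>)"
      have "1 \<le> R powr (-\<eta>)"
        using R \<open>0 < \<eta>\<close> powr_mono'[of "-\<eta>" 0 R] by simp
      then have "1 * 1 \<le> B" unfolding B_def using B0 by (intro mult_mono) auto
      then have B: "1 \<le> B" by simp
      have overlap: "real (card (P t \<inter> P t')) \<le> B / max \<bar>t - t'\<bar> (L / 2 ^ n)" if t: "t \<in> E" "t' \<in> E" for t t'
      proof (cases "\<bar>t - t'\<bar> < L * R")
        case True
        \<comment> \<open>For nearly parallel strips all of \<open>G\<close> is allowed: by
          \<open>s \<le> 1\<close> its size is of order at most \<open>1 / R\<close>, up to the
          loss, like the truncated kernel.\<close>
        have "card (P t \<inter> P t') \<le> card G" using PG[OF t(1)] finG by (intro card_mono) auto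
        then have "real (card (P t \<inter> P t')) \<le> C * D * R powr (-\<eta>) * R powr (-s)" using cardG by linarith
        also have "\<dots> \<le> C * D * R powr (-\<eta>) * R powr (-1)"
          using C(1) D(1) R s by (intro mult_left_mono powr_mono') auto
        also have "\<dots> = (C * (D * L)) * R powr (-\<eta>) / (L * R)"
          using R L by (simp add: powr_minus_divide)
        also have "\<dots> \<le> B / (L * R)"
          unfolding B_def B0_def using C(1) R L by (intro divide_right_mono mult_right_mono mult_left_mono) auto
        also have "L * R = max \<bar>t - t'\<bar> (L / 2 ^ n)" using True by (simp add: R_def)
        finally show ?thesis .
      next
        case False
        let ?\<phi> = "\<bar>t - t'\<bar>"
        have \<phi>: "0 < ?\<phi>" "t \<noteq> t'" using False mult_pos_pos[OF L R(1)] by auto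
        have tT: "\<bar>t\<bar> \<le> T" "\<bar>t'\<bar> \<le> T" using T(2) EI t by auto
        have "?\<phi> \<le> 20 * T\<^sup>2"
        proof -
          have "?\<phi> \<le> 2 * T" using tT by linarith
          also have "\<dots> \<le> 20 * T\<^sup>2" using T(1) by (simp add: power2_eq_square)
          finally show ?thesis .
        qed
        then have one: "1 \<le> 20 * T\<^sup>2 / ?\<phi>" using \<phi>(1) by (simp add: pos_le_divide_eq)
        have "card (P t \<inter> P t') \<le> card (grid R ` (X \<inter> strip t (x t) R) \<inter> grid R ` (X \<inter> strip t' (x t') R))"
          using P(1)[OF t(1)] P(1)[OF t(2)] R X by (intro card_mono finite_Int disjI1 finite_grid) auto
        also have "real \<dots> \<le> C * R powr (-\<eta>) * (20 * T\<^sup>2 / ?\<phi>)"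
        proof (rule card_grid_strip_Int_le[OF R(1) T(1) tT \<phi>(2) X(1)])
          fix p assume p: "p \<in> X"
          have "R * 1 \<le> R * (20 * T\<^sup>2 / ?\<phi>)" using one R by (intro mult_left_mono) auto
          then have "R \<le> 20 * T\<^sup>2 * R / ?\<phi>" by (simp add: mult_ac)
          from C0(2)[OF R this p]
          have "real (card (grid R ` (X \<inter> cball p (20 * T\<^sup>2 * R / ?\<phi>))))
              \<le> C0 * R powr (-\<eta>) * (20 * T\<^sup>2 * R / ?\<phi> / R) powr s" .
          also have "20 * T\<^sup>2 * R / ?\<phi> / R = 20 * T\<^sup>2 / ?\<phi>" using R by simp
          also have "C0 * R powr (-\<eta>) * (20 * T\<^sup>2 / ?\<phi>) powr s \<le> C * R powr (-\<eta>) * (20 * T\<^sup>2 / ?\<phi>) powr 1"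
            using C C0(1) one s by (intro mult_mono powr_mono[of s 1 "20 * T\<^sup>2 / ?\<phi>"]) auto
          also have "\<dots> = C * R powr (-\<eta>) * (20 * T\<^sup>2 / ?\<phi>)" using one by simp
          finally show "real (card (grid R ` (X \<inter> cball p (20 * T\<^sup>2 * R / ?\<phi>)))) \<le> C * R powr (-\<eta>) * (20 * T\<^sup>2 / ?\<phi>)" .
        qed (use C(1) in simp)
        also have "\<dots> = (C * (20 * T\<^sup>2)) * R powr (-\<eta>) / ?\<phi>" by simp
        also have "\<dots> \<le> B / ?\<phi>"
          unfolding B_def B0_def using C(1) D(1) L \<phi>(1) by (intro divide_right_mono mult_right_mono mult_left_mono) auto
        also have "?\<phi> = max ?\<phi> (L / 2 ^ n)" using False by (simp add: R_def)
        finally show ?thesis by simp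
      qed
      have E0: "E \<subseteq> dyadic c L 0 0" using EI I(2) by blast
      from dyadic_cover_of_incidences[OF L less_imp_le[OF \<alpha>(1)] \<alpha>(2) E0 finG PG P(2) m(1) _ overlap] B
      obtain Q where Q: "finite Q" "E \<subseteq> (\<Union>p\<in>Q. dyadic c L (fst p) (snd p))"
        "(\<Sum>p\<in>Q. (L / 2 ^ fst p) powr \<alpha>) \<le> real (card G) * real m powr (- 1 - \<alpha>) * B powr \<alpha> * (6 * (real n + 1))"
        by auto
      note Q(3)
      also have "real (card G) * real m powr (- 1 - \<alpha>) * B powr \<alpha> * (6 * (real n + 1))
          \<le> (C * D * R powr (-\<eta>) * R powr (-s)) * R powr (s + \<epsilon>) * (B0 * R powr (-\<eta>)) * (6 * (real n + 1))"
      proof (intro mult_mono cardG)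
        have "real m powr (- 1 - \<alpha>) \<le> ((1 / R) powr v) powr (- 1 - \<alpha>)"
          using m(2) big \<alpha> by (intro powr_mono2') auto
        also have "\<dots> = R powr (v * (1 + \<alpha>))"
          using R by (simp add: powr_powr powr_divide powr_minus_divide[symmetric] algebra_simps)
        also have "\<dots> \<le> R powr (s + \<epsilon>)"
          unfolding v(2) using R \<alpha> \<open>0 < \<epsilon>\<close> by (intro powr_mono') auto
        finally show "real m powr (- 1 - \<alpha>) \<le> R powr (s + \<epsilon>)" .
        have "B powr \<alpha> \<le> B powr 1" using B \<alpha> by (intro powr_mono) auto
        then show "B powr \<alpha> \<le> B0 * R powr (-\<eta>)" using B by (simp add: B_def)
      qed (use C(1) D(1) B0 in auto)
      also have "\<dots> = C * D * B0 * 6 * (real (Suc n) * (R powr (-\<eta>) * R powr (-s) * R powr (s + \<epsilon>) * R powr (-\<eta>)))"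
        by (simp add: mult_ac)
      also have "R powr (-\<eta>) * R powr (-s) * R powr (s + \<epsilon>) * R powr (-\<eta>) = R powr (\<epsilon> / 2)"
        unfolding powr_add[symmetric] \<eta>_def by (simp add: field_simps)
      also have "R powr (\<epsilon> / 2) = (2 powr (- \<epsilon> / 2)) ^ n"
      proof -
        have "R = 2 powr (- real n)" by (simp add: R_def powr_minus_divide powr_realpow)
        then show ?thesis by (simp add: powr_powr powr_power mult.commute)
      qed
      finally show "\<exists>Q. finite Q \<and> rich_directions X I (s / (1 + \<alpha>) + \<epsilon>) n \<subseteq> (\<Union>p\<in>Q. dyadic c L (fst p) (snd p))
          \<and> (\<Sum>p\<in>Q. (L / 2 ^ fst p) powr \<alpha>) \<le> C * D * B0 * 6 * (real (Suc n) * (2 powr (- \<epsilon> / 2)) ^ n)"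
        using Q(1,2) by (intro exI[of _ Q]) (auto simp: E_def v_def)
    qed
  qed
qed

lemma bounded_subset_dyadic:
  fixes I :: "real set"
  assumes "bounded I"
  obtains c L where "0 < L" "I \<subseteq> dyadic c L 0 0"
proof -
  obtain T where T: "0 < T" "\<And>t. t \<in> I \<Longrightarrow> \<bar>t\<bar> \<le> T"
    using assms unfolding bounded_pos by auto
  \<comment> \<open>The extra 1 makes room for the right end point \<open>T\<close>, which a
    half-open cell of length \<open>2 * T\<close> starting at \<open>-T\<close> would miss.\<close>
  have "I \<subseteq> dyadic (-T) (2 * T + 1) 0 0"
  proof
    fix t assume "t \<in> I"
    then have "0 \<le> t + T" "t + T < 2 * T + 1" using T(2)[of t] T(1) by auto
    then have "0 \<le> (t - - T) / (2 * T + 1)" "(t - - T) / (2 * T + 1) < 1" using T(1) by auto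
    then show "t \<in> dyadic (-T) (2 * T + 1) 0 0" unfolding dyadic_def by (simp add: floor_eq_iff)
  qed
  then show thesis using T(1) by (intro that[of "2 * T + 1" "-T"]) auto
qed

text \<open>The cover costs are a multiple of \<open>(n + 1) * z ^ n\<close> with
  \<open>z < 1\<close>, hence summable, and Borel--Cantelli applies.\<close>

lemma rich_directions_limsup_null:
  assumes X: "bounded X" "quasi_assouad_dim X \<le> s" and s: "0 \<le> s" "s \<le> 1" and \<alpha>: "0 < \<alpha>" "\<alpha> \<le> 1"
    and "0 < \<epsilon>" and I: "bounded I"
  shows "hausdorff_measure \<alpha> {t. \<forall>k. \<exists>n\<ge>k. t \<in> rich_directions X I (s / (1 + \<alpha>) + \<epsilon>) n} = 0"
proof -
  obtain c L where L: "0 < L" "I \<subseteq> dyadic c L 0 0" using bounded_subset_dyadic[OF I] by blast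
  obtain C where C': "0 < C" "\<forall>n\<ge>1. \<exists>Q. finite Q
    \<and> rich_directions X I (s / (1 + \<alpha>) + \<epsilon>) n \<subseteq> (\<Union>p\<in>Q. dyadic c L (fst p) (snd p))
    \<and> (\<Sum>p\<in>Q. (L / 2 ^ fst p) powr \<alpha>) \<le> C * (real (Suc n) * (2 powr (- \<epsilon> / 2)) ^ n)"
    by (rule rich_directions_cover[OF X s \<alpha> \<open>0 < \<epsilon>\<close> L(1) I L(2)])
  define E where "E = rich_directions X I (s / (1 + \<alpha>) + \<epsilon>)"
  define z where "z = 2 powr (- \<epsilon> / 2)"
  note C = C'[folded E_def z_def]
  define g where "g n = C * (real (Suc n) * z ^ n)" for n
  have "0 \<le> z" "z < 1" using \<open>0 < \<epsilon>\<close> powr_less_mono[of "- \<epsilon> / 2" 0 2] by (auto simp: z_def)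
  then have "summable (\<lambda>n. real (Suc n) * z ^ n)"
    using geometric_deriv_sums[of z] by (simp add: sums_iff)
  then have g: "summable g" "\<And>n. 0 \<le> g n"
    using C(1) \<open>0 \<le> z\<close> by (auto simp: g_def[abs_def] intro: summable_mult)
  have "\<exists>k. \<forall>n\<ge>k. hausdorff_premeasure \<delta> \<alpha> (E n) \<le> ennreal (g n)" if "0 < \<delta>" for \<delta>
  proof -
    have "0 < \<delta> powr \<alpha>" using that by simp
    then have "\<forall>\<^sub>F n in sequentially. g n < \<delta> powr \<alpha>"
      using summable_LIMSEQ_zero[OF g(1)] by (intro order_tendstoD(2))
    then obtain k where k: "\<And>n. n \<ge> k \<Longrightarrow> g n < \<delta> powr \<alpha>" by (auto simp: eventually_sequentially)
    have "hausdorff_premeasure \<delta> \<alpha> (E n) \<le> ennreal (g n)" if n: "n \<ge> max 1 k" for n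
    proof -
      have n1: "1 \<le> n" using n by simp
      obtain Q where Q: "finite Q" "E n \<subseteq> (\<Union>p\<in>Q. dyadic c L (fst p) (snd p))"
        "(\<Sum>p\<in>Q. (L / 2 ^ fst p) powr \<alpha>) \<le> g n"
        using C(2)[rule_format, OF n1] unfolding g_def by (elim exE conjE)
      \<comment> \<open>The levels in \<open>Q\<close> are not prescribed, but a cell with
        \<open>L / 2 ^ fst p\<close> above \<open>\<delta>\<close> would alone cost at least
        \<open>\<delta> powr \<alpha>\<close>, more than the whole cover for large
        \<open>n\<close>.\<close>
      have small: "L / 2 ^ fst p \<le> \<delta>" if "p \<in> Q" for p
      proof (rule ccontr)
        assume "\<not> L / 2 ^ fst p \<le> \<delta>"
        then have "\<delta> powr \<alpha> \<le> (L / 2 ^ fst p) powr \<alpha>" using \<open>0 < \<delta>\<close> \<alpha> by (intro powr_mono2) auto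
        also have "\<dots> \<le> (\<Sum>p\<in>Q. (L / 2 ^ fst p) powr \<alpha>)" using that Q(1) by (intro member_le_sum) auto
        finally show False using Q(3) k[of n] n by simp
      qed
      have "hausdorff_premeasure \<delta> \<alpha> (E n) \<le> (\<Sum>p\<in>Q. diam_pow \<alpha> (dyadic c L (fst p) (snd p)))"
      proof (rule hausdorff_premeasure_le_finite[OF Q(1) _ Q(2)])
        show "bounded (dyadic c L (fst p) (snd p))" for p by (rule dyadic_diameter(1)[OF L(1)])
        show "diameter (dyadic c L (fst p) (snd p)) \<le> \<delta>" if "p \<in> Q" for p
          using dyadic_diameter(2)[OF L(1)] small[OF that] by (rule order_trans)
      qed (use \<open>0 < \<delta>\<close> in simp)
      also have "\<dots> \<le> (\<Sum>p\<in>Q. ennreal ((L / 2 ^ fst p) powr \<alpha>))"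
      proof (rule sum_mono)
        fix p
        show "diam_pow \<alpha> (dyadic c L (fst p) (snd p)) \<le> ennreal ((L / 2 ^ fst p) powr \<alpha>)"
          using \<alpha> dyadic_diameter[OF L(1), of c "fst p" "snd p"] diameter_ge_0[of "dyadic c L (fst p) (snd p)"]
          by (auto simp: diam_pow_def intro!: ennreal_leI powr_mono2)
      qed
      also have "\<dots> = ennreal (\<Sum>p\<in>Q. (L / 2 ^ fst p) powr \<alpha>)" by (rule sum_ennreal) simp
      also have "\<dots> \<le> ennreal (g n)" using Q(3) by (rule ennreal_leI)
      finally show ?thesis .
    qed
    then show ?thesis by blast
  qed
  with g show ?thesis unfolding E_def[symmetric] by (rule hausdorff_measure_limsup_null)
qed

section \<open>The Assouad spectrum of projections\<close>

lemma bounded_real_finite_cover: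
  fixes S :: "real set"
  assumes "bounded S" "0 < \<rho>"
  obtains C where "finite C" "S \<subseteq> (\<Union>c\<in>C. cball c \<rho>)"
proof -
  have "compact (closure S)" using assms(1) by (simp add: compact_closure)
  then obtain C where C: "finite C" "closure S \<subseteq> (\<Union>c\<in>C. ball c \<rho>)"
    unfolding compact_eq_totally_bounded using assms(2) by blast
  have "S \<subseteq> (\<Union>c\<in>C. ball c \<rho>)" using closure_subset C(2) by (rule order_trans)
  also have "\<dots> \<subseteq> (\<Union>c\<in>C. cball c \<rho>)" by (intro UN_mono ball_subset_cball) simp
  finally show thesis by (rule that[OF C(1)])
qed

text \<open>\<open>proj t\<close> stretches a cell by a factor of at most
  \<open>1 + \<bar>t\<bar>\<close>, so the image of one chosen point per cell of the reduced mesh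
  can serve as a centre.\<close>

lemma covering_number_proj_le:
  assumes "0 < \<rho>" "bounded A"
  shows "covering_number \<rho> (proj t ` A) \<le> card (grid (\<rho> / (1 + \<bar>t\<bar>)) ` A)"
proof -
  define \<sigma> where "\<sigma> = \<rho> / (1 + \<bar>t\<bar>)"
  have \<sigma>: "0 < \<sigma>" "(1 + \<bar>t\<bar>) * \<sigma> = \<rho>" using assms(1) by (auto simp: \<sigma>_def)
  define z where "z g = proj t (SOME p. p \<in> A \<and> grid \<sigma> p = g)" for g
  have fin: "finite (grid \<sigma> ` A)" using \<sigma>(1) assms(2) by (rule finite_grid)
  have "proj t ` A \<subseteq> (\<Union>c\<in>z ` grid \<sigma> ` A. cball c \<rho>)"
  proof
    fix y assume "y \<in> proj t ` A"
    then obtain p where p: "p \<in> A" "y = proj t p" by blast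
    define q where "q = (SOME q. q \<in> A \<and> grid \<sigma> q = grid \<sigma> p)"
    have "q \<in> A \<and> grid \<sigma> q = grid \<sigma> p" unfolding q_def by (rule someI[of _ p]) (simp add: p(1))
    then have "\<bar>proj t q - proj t p\<bar> \<le> (1 + \<bar>t\<bar>) * \<sigma>"
      using \<sigma>(1) by (intro proj_dist_le grid_eq_imp_close) auto
    then have "y \<in> cball (z (grid \<sigma> p)) \<rho>"
      by (simp add: z_def q_def[symmetric] p(2) \<sigma>(2) dist_real_def)
    then show "y \<in> (\<Union>c\<in>z ` grid \<sigma> ` A. cball c \<rho>)" using p(1) by blast
  qed
  then have "covering_number \<rho> (proj t ` A) \<le> card (z ` grid \<sigma> ` A)"
    using fin by (intro covering_number_le_card) auto
  also have "\<dots> \<le> card (grid \<sigma> ` A)" using fin by (rule card_image_le)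
  finally show ?thesis by (simp add: \<sigma>_def)
qed

text \<open>The part of \<open>X\<close> over a ball of radius \<open>R\<close> lies in a strip that
  meets about \<open>R powr (-v)\<close> cells of size \<open>R\<close>, each containing at most
  \<open>(R / \<rho>) powr s\<close> cells of size \<open>\<rho>\<close>, up to
  \<open>\<rho> powr (-\<eta>)\<close>. At \<open>\<rho> = R powr (1 / \<theta>)\<close> one has
  \<open>R powr (-v) = (R / \<rho>) powr (v * \<theta> / (1 - \<theta>))\<close>.\<close>

lemma assouad_spectrum_proj_le:
  assumes X: "bounded X" "quasi_assouad_dim X \<le> s" "0 \<le> s" and \<theta>: "0 < \<theta>" "\<theta> < 1" and "0 < \<eta>" and "0 \<le> v"
    and poor: "\<And>n x. k \<le> n \<Longrightarrow> real (card (grid (1 / 2 ^ n) ` (X \<inter> strip t x (1 / 2 ^ n)))) \<le> (2 ^ n) powr v"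
  shows "assouad_spectrum \<theta> (proj t ` X) \<le> s + (v * \<theta> + \<eta>) / (1 - \<theta>)"
proof -
  obtain C0 where C0: "0 < C0" "\<And>\<rho> d y. 0 < \<rho> \<Longrightarrow> \<rho> < 1 \<Longrightarrow> \<rho> \<le> d \<Longrightarrow> y \<in> X \<Longrightarrow>
      real (card (grid \<rho> ` (X \<inter> cball y d))) \<le> C0 * \<rho> powr (-\<eta>) * (d / \<rho>) powr s"
    using grid_bound_all_scales[OF X(1,2) \<open>0 < \<eta>\<close>] by blast
  \<comment> \<open>Absorbs the finitely many scales \<open>n < k\<close>, about which
    \<open>poor\<close> says nothing.\<close>
  define C1 where "C1 = 1 + (\<Sum>n<k. real (card (grid (1 / 2 ^ n) ` X)))"
  have "1 \<le> C1" unfolding C1_def by (simp add: sum_nonneg)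
  have C1: "real (card (grid (1 / 2 ^ n) ` (X \<inter> strip t x (1 / 2 ^ n)))) \<le> C1 * (2 ^ n) powr v" for n x
  proof (cases "k \<le> n")
    case True
    have "real (card (grid (1 / 2 ^ n) ` (X \<inter> strip t x (1 / 2 ^ n)))) \<le> 1 * (2 ^ n) powr v"
      using poor[OF True] by simp
    also have "\<dots> \<le> C1 * (2 ^ n) powr v" using \<open>1 \<le> C1\<close> by (intro mult_right_mono) auto
    finally show ?thesis .
  next
    case False
    have "card (grid (1 / 2 ^ n) ` (X \<inter> strip t x (1 / 2 ^ n))) \<le> card (grid (1 / 2 ^ n) ` X)"
      using X(1) by (intro card_grid_mono) auto
    then have "real (card (grid (1 / 2 ^ n) ` (X \<inter> strip t x (1 / 2 ^ n)))) \<le> real (card (grid (1 / 2 ^ n) ` X))"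
      by (simp only: of_nat_le_iff)
    also have "\<dots> \<le> (\<Sum>n<k. real (card (grid (1 / 2 ^ n) ` X)))"
      using False by (intro member_le_sum) auto
    also have "\<dots> \<le> C1 * 1" by (simp add: C1_def)
    also have "\<dots> \<le> C1 * (2 ^ n) powr v"
      using \<open>1 \<le> C1\<close> \<open>0 \<le> v\<close> by (intro mult_left_mono ge_one_powr_ge_zero) auto
    finally show ?thesis .
  qed
  define T where "T = 1 + \<bar>t\<bar>"
  have T: "1 \<le> T" by (simp add: T_def)
  \<comment> \<open>\<open>4 * T\<close> arises from \<open>\<sigma> \<le> 2 * R\<close> and
    \<open>\<rho>' = \<rho> / T\<close> in the ratio \<open>2 * \<sigma> / \<rho>'\<close>, and
    \<open>T powr \<eta>\<close> from returning to \<open>\<rho>\<close> in the loss factor.\<close>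
  define C where "C = C1 * C0 * T powr \<eta> * (4 * T) powr s"
  have "0 < C" using \<open>1 \<le> C1\<close> C0(1) T by (simp add: C_def)
  show ?thesis
  proof (rule assouad_spectrum_le(2)[OF _ \<open>0 < C\<close>])
    show "0 \<le> s + (v * \<theta> + \<eta>) / (1 - \<theta>)" using X(3) \<theta> \<open>0 < \<eta>\<close> \<open>0 \<le> v\<close> by simp
    fix R :: real and x assume R: "0 < R" "R < 1"
    define \<rho> where "\<rho> = R powr (1 / \<theta>)"
    have \<rho>: "0 < \<rho>" "\<rho> \<le> R" using R powr_inverse_le_self[OF R \<theta>] by (auto simp: \<rho>_def)
    have "\<exists>n. 1 / 2 ^ n < R"
      using real_arch_pow_inv[OF R(1), of "1 / 2"] by (auto simp: power_one_over)
    then have least: "1 / 2 ^ (LEAST n. 1 / 2 ^ n < R) < R" by (rule LeastI_ex)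
    \<comment> \<open>The least index is not 0 because \<open>R < 1\<close>; its predecessor
      \<open>n\<close> gives a dyadic scale with
      \<open>R \<le> 1 / 2 ^ n \<le> 2 * R\<close>.\<close>
    obtain n where n: "(LEAST n. 1 / 2 ^ n < R) = Suc n"
      using least R by (cases "LEAST n. 1 / 2 ^ n < R") auto
    define \<sigma> where "\<sigma> = 1 / (2::real) ^ n"
    have "\<not> 1 / 2 ^ n < R" using not_less_Least[of n "\<lambda>n. 1 / 2 ^ n < R"] n by simp
    moreover have "1 / 2 ^ Suc n < R" using least by (simp only: n)
    ultimately have \<sigma>: "R \<le> \<sigma>" "\<sigma> \<le> 2 * R" "0 < \<sigma>" by (auto simp: \<sigma>_def)
    define A where "A = X \<inter> strip t x \<sigma>"
    have A: "bounded A" using X(1) by (auto simp: A_def)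
    have "proj t ` X \<inter> cball x R \<subseteq> proj t ` A"
      using \<sigma>(1) by (auto simp: A_def strip_def dist_real_def)
    define \<rho>' where "\<rho>' = \<rho> / T"
    have \<rho>': "0 < \<rho>'" "\<rho>' \<le> \<rho>" "\<rho>' < 1" using \<rho> R T by (auto simp: \<rho>'_def divide_le_eq divide_less_eq)
    \<comment> \<open>Monotonicity of \<open>covering_number\<close> is obtained from a minimal
      cover of the larger set, so that set is first shown to have a finite cover.\<close>
    have mono: "covering_number \<rho> (proj t ` X \<inter> cball x R) \<le> covering_number \<rho> (proj t ` A)"
    proof -
      have "bounded (proj t ` A)"
      proof -
        obtain D where D: "\<And>p. p \<in> A \<Longrightarrow> norm p \<le> D" using A unfolding bounded_iff by blast
        have "norm (proj t p) \<le> T * D" if "p \<in> A" for p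
        proof -
          have "\<bar>fst p\<bar> \<le> D" "\<bar>snd p\<bar> \<le> D"
            using D[OF that] norm_fst_le[of "fst p" "snd p"] norm_snd_le[of "snd p" "fst p"] by auto
          then have "\<bar>proj t p - proj t 0\<bar> \<le> (1 + \<bar>t\<bar>) * D" by (intro proj_dist_le) auto
          then show ?thesis by (simp add: T_def proj_def)
        qed
        then show ?thesis unfolding bounded_iff by blast
      qed
      then obtain S where S: "finite S" "proj t ` A \<subseteq> (\<Union>c\<in>S. cball c \<rho>)"
        by (rule bounded_real_finite_cover[OF _ \<rho>(1)])
      obtain D where "finite D" "card D = covering_number \<rho> (proj t ` A)" "proj t ` A \<subseteq> (\<Union>c\<in>D. cball c \<rho>)"
        using S by (rule covering_number_attained)
      then show ?thesis
        using covering_number_le_card[of D "proj t ` X \<inter> cball x R" \<rho>] \<open>proj t ` X \<inter> cball x R \<subseteq> proj t ` A\<close> by auto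
    qed
    also have "\<dots> \<le> card (grid \<rho>' ` A)"
      unfolding \<rho>'_def T_def using \<rho>(1) A by (rule covering_number_proj_le)
    finally have "real (covering_number \<rho> (proj t ` X \<inter> cball x R)) \<le> real (card (grid \<rho>' ` A))" by simp
    also have "\<dots> \<le> real (card (grid \<sigma> ` A)) * (C0 * \<rho>' powr (-\<eta>) * (2 * \<sigma> / \<rho>') powr s)"
    proof (rule card_grid_split[OF \<rho>'(1) \<sigma>(3) A])
      fix y assume "y \<in> A"
      then have "y \<in> X" by (simp add: A_def)
      have "card (grid \<rho>' ` (A \<inter> cball y (2 * \<sigma>))) \<le> card (grid \<rho>' ` (X \<inter> cball y (2 * \<sigma>)))"
        using \<rho>'(1) X(1) by (intro card_grid_mono) (auto simp: A_def)
      moreover have "\<rho>' \<le> 2 * \<sigma>" using \<rho>' \<rho> \<sigma> by linarith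
      ultimately show "real (card (grid \<rho>' ` (A \<inter> cball y (2 * \<sigma>)))) \<le> C0 * \<rho>' powr (-\<eta>) * (2 * \<sigma> / \<rho>') powr s"
        using C0(2)[OF \<rho>'(1,3) _ \<open>y \<in> X\<close>, of "2 * \<sigma>"] by linarith
    qed
    also have "\<dots> \<le> (C1 * R powr (-v)) * (C0 * (T powr \<eta> * \<rho> powr (-\<eta>)) * ((4 * T) powr s * (R / \<rho>) powr s))"
    proof (intro mult_mono)
      have "real (card (grid \<sigma> ` A)) \<le> C1 * (2 ^ n) powr v" using C1[of n x] by (simp add: A_def \<sigma>_def)
      also have "(2 ^ n) powr v \<le> (1 / R) powr v"
        using \<sigma> R \<open>0 \<le> v\<close> by (intro powr_mono2) (auto simp: \<sigma>_def field_simps)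
      also have "(1 / R) powr v = R powr (-v)" using R by (simp add: powr_divide powr_minus_divide)
      finally show "real (card (grid \<sigma> ` A)) \<le> C1 * R powr (-v)" using \<open>1 \<le> C1\<close> by simp
      show "\<rho>' powr (-\<eta>) \<le> T powr \<eta> * \<rho> powr (-\<eta>)"
        using \<rho>(1) T by (simp add: \<rho>'_def powr_divide powr_minus_divide)
      have "(2 * \<sigma> / \<rho>') powr s \<le> (4 * T * (R / \<rho>)) powr s"
      proof (rule powr_mono2)
        have "2 * \<sigma> * T / \<rho> \<le> 4 * R * T / \<rho>" using \<sigma> T \<rho>(1) by (intro divide_right_mono mult_right_mono) auto
        then show "2 * \<sigma> / \<rho>' \<le> 4 * T * (R / \<rho>)" by (simp add: \<rho>'_def mult_ac)
      qed (use X(3) \<sigma> \<rho>' in auto)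
      also have "\<dots> = (4 * T) powr s * (R / \<rho>) powr s" using T R \<rho> by (intro powr_mult)
      finally show "(2 * \<sigma> / \<rho>') powr s \<le> (4 * T) powr s * (R / \<rho>) powr s" .
    qed (use C0(1) \<open>1 \<le> C1\<close> in auto)
    also have "\<dots> = C * ((R / \<rho>) powr s * (R powr (-v) * \<rho> powr (-\<eta>)))" by (simp add: C_def mult_ac)
    also have "R powr (-v) * \<rho> powr (-\<eta>) = (R / \<rho>) powr ((v * \<theta> + \<eta>) / (1 - \<theta>))"
    proof -
      have "R / \<rho> = R powr 1 / R powr (1 / \<theta>)" using R by (simp add: \<rho>_def)
      also have "\<dots> = R powr (1 - 1 / \<theta>)" by (simp only: powr_diff[symmetric])
      finally have "(R / \<rho>) powr ((v * \<theta> + \<eta>) / (1 - \<theta>)) = R powr ((1 - 1 / \<theta>) * ((v * \<theta> + \<eta>) / (1 - \<theta>)))"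
        by (simp add: powr_powr)
      also have "(1 - 1 / \<theta>) * ((v * \<theta> + \<eta>) / (1 - \<theta>)) = - v + 1 / \<theta> * -\<eta>"
      proof -
        have "1 - 1 / \<theta> = - ((1 - \<theta>) / \<theta>)" using \<theta> by (simp add: field_simps)
        then have "(1 - 1 / \<theta>) * ((v * \<theta> + \<eta>) / (1 - \<theta>)) = - ((v * \<theta> + \<eta>) / \<theta>)" using \<theta> by simp
        also have "\<dots> = - v + 1 / \<theta> * -\<eta>" using \<theta> by (simp add: add_divide_distrib)
        finally show ?thesis .
      qed
      finally have "(R / \<rho>) powr ((v * \<theta> + \<eta>) / (1 - \<theta>)) = R powr (- v + 1 / \<theta> * -\<eta>)" .
      moreover have "\<rho> powr (-\<eta>) = R powr (1 / \<theta> * -\<eta>)" by (simp add: \<rho>_def powr_powr)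
      ultimately show ?thesis by (simp only: powr_add)
    qed
    finally show "real (covering_number \<rho> (proj t ` X \<inter> cball x R)) \<le> C * (R / \<rho>) powr (s + (v * \<theta> + \<eta>) / (1 - \<theta>))"
      by (simp add: powr_add)
  qed
qed

text \<open>An interval of length \<open>2 * R\<close> is covered by equally spaced balls, at most
  \<open>2 * R / \<rho> + 2\<close> in number. This settles the case \<open>s > 1\<close>.\<close>

lemma assouad_spectrum_real_le_1:
  fixes K :: "real set"
  assumes \<theta>: "0 < \<theta>" "\<theta> < 1"
  shows "assouad_spectrum \<theta> K \<le> 1"
proof (rule assouad_spectrum_le(2)[of _ 5])
  fix R x :: real assume R: "0 < R" "R < 1"
  define \<rho> where "\<rho> = R powr (1 / \<theta>)"
  have \<rho>: "0 < \<rho>" "\<rho> \<le> R" using R powr_inverse_le_self[OF R \<theta>] by (auto simp: \<rho>_def)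
  define J where "J = {\<lfloor>- R / \<rho>\<rfloor>..\<lfloor>R / \<rho>\<rfloor>}"
  define z where "z i = x + of_int i * \<rho>" for i
  have "K \<inter> cball x R \<subseteq> (\<Union>c\<in>z ` J. cball c \<rho>)"
  proof
    fix y assume "y \<in> K \<inter> cball x R"
    then have y: "\<bar>y - x\<bar> \<le> R" by (simp add: dist_real_def abs_minus_commute)
    define i where "i = \<lfloor>(y - x) / \<rho>\<rfloor>"
    have "- R \<le> y - x" "y - x \<le> R" using y by (simp_all add: abs_le_iff)
    then have "i \<in> J"
      unfolding i_def J_def atLeastAtMost_iff using \<rho>(1) by (intro conjI floor_mono divide_right_mono) simp_all
    have "\<bar>of_int i - (y - x) / \<rho>\<bar> \<le> 1" unfolding i_def by linarith
    then have "\<bar>of_int i - (y - x) / \<rho>\<bar> * \<rho> \<le> 1 * \<rho>" using \<rho>(1) by (intro mult_right_mono) auto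
    also have "\<bar>of_int i - (y - x) / \<rho>\<bar> * \<rho> = \<bar>(of_int i - (y - x) / \<rho>) * \<rho>\<bar>" using \<rho>(1) by (simp add: abs_mult)
    also have "(of_int i - (y - x) / \<rho>) * \<rho> = z i - y" using \<rho>(1) by (simp add: z_def field_simps)
    finally show "y \<in> (\<Union>c\<in>z ` J. cball c \<rho>)" using \<open>i \<in> J\<close> by (auto simp: dist_real_def)
  qed
  then have "covering_number \<rho> (K \<inter> cball x R) \<le> card (z ` J)"
    by (intro covering_number_le_card) (auto simp: J_def)
  also have "\<dots> \<le> card J" by (rule card_image_le) (simp add: J_def)
  finally have "real (covering_number \<rho> (K \<inter> cball x R)) \<le> real (card J)" by simp
  also have "\<dots> \<le> R / \<rho> - (- R / \<rho>) + 2"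
    unfolding J_def using R \<rho> by (intro card_floor_interval_le divide_right_mono) auto
  also have "\<dots> \<le> 5 * (R / \<rho>)" using R \<rho> by (simp add: field_simps)
  also have "\<dots> = 5 * (R / \<rho>) powr 1" using R \<rho> by simp
  finally show "real (covering_number \<rho> (K \<inter> cball x R)) \<le> 5 * (R / \<rho>) powr 1" .
qed auto

text \<open>The threshold equals \<open>s + u * \<theta> / (1 - \<theta>)\<close> for
  \<open>u = s / (1 + \<alpha>)\<close>. A direction exceeding it by a fixed amount is rich at
  infinitely many scales, as otherwise \<open>assouad_spectrum_proj_le\<close> would contradict the
  excess. Countably many sizes of excess exhaust the set.\<close>

lemma exceptional_directions_null:
  assumes X: "bounded X" "quasi_assouad_dim X \<le> s" and "0 \<le> s" and I: "bounded I"
    and \<theta>: "0 < \<theta>" "\<theta> < 1" and \<alpha>: "0 < \<alpha>" "\<alpha> \<le> 1"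
  shows "hausdorff_measure \<alpha> {t \<in> I. 1 / (1 + \<alpha>) * (s / (1 - \<theta>) + \<alpha> * s) < assouad_spectrum \<theta> (proj t ` X)} = 0"
proof (cases "s \<le> 1")
  case False
  \<comment> \<open>For \<open>s > 1\<close> the threshold is at least 1, which no subset of the
    line exceeds.\<close>
  have "1 \<le> 1 / (1 - \<theta>)" using \<theta> by simp
  then have "s * 1 \<le> s * (1 / (1 - \<theta>))" using \<open>0 \<le> s\<close> by (intro mult_left_mono) auto
  then have "1 + \<alpha> * 1 \<le> s / (1 - \<theta>) + \<alpha> * s" using False \<alpha> by (intro add_mono mult_left_mono) auto
  then have "1 \<le> 1 / (1 + \<alpha>) * (s / (1 - \<theta>) + \<alpha> * s)" using \<alpha> by (simp add: pos_le_divide_eq)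
  then have "{t \<in> I. 1 / (1 + \<alpha>) * (s / (1 - \<theta>) + \<alpha> * s) < assouad_spectrum \<theta> (proj t ` X)} = {}"
    using assouad_spectrum_real_le_1[OF \<theta>] by (auto simp: not_less intro: order_trans)
  moreover have "hausdorff_premeasure \<delta> \<alpha> ({}::real set) = 0" if "0 < \<delta>" for \<delta>
    using hausdorff_premeasure_le_finite[of "{}" \<delta> "{}" "\<lambda>_. {}" \<alpha>] that by simp
  then have "hausdorff_measure \<alpha> ({}::real set) = 0" by (simp add: hausdorff_measure_eq_0_iff)
  ultimately show ?thesis by (simp only:)
next
  case True
  let ?f = "1 / (1 + \<alpha>) * (s / (1 - \<theta>) + \<alpha> * s)"
  define u where "u = s / (1 + \<alpha>)"
  have "0 \<le> u" using \<open>0 \<le> s\<close> \<alpha> by (simp add: u_def)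
  have f: "s + u * \<theta> / (1 - \<theta>) = ?f"
  proof -
    have "s = u * (1 + \<alpha>)" using \<alpha> by (simp add: u_def)
    then have "s + u * \<theta> / (1 - \<theta>) = u * (1 + \<theta> / (1 - \<theta>) + \<alpha>)" by (simp add: algebra_simps)
    also have "1 + \<theta> / (1 - \<theta>) = 1 / (1 - \<theta>)" using \<theta> by (simp add: field_simps)
    also have "u * (1 / (1 - \<theta>) + \<alpha>) = ?f" by (simp add: u_def distrib_left mult_ac)
    finally show ?thesis .
  qed
  define F where "F m = {t \<in> I. ?f + inverse (real (Suc m)) < assouad_spectrum \<theta> (proj t ` X)}" for m
  have "hausdorff_measure \<alpha> (F m) = 0" for m
  proof -
    \<comment> \<open>The error in the spectrum bound is
      \<open>\<epsilon> * (1 + \<theta>) / (1 - \<theta>)\<close>; as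
      \<open>1 + \<theta> \<le> 2\<close>, this choice keeps it within
      \<open>inverse (Suc m)\<close>.\<close>
    define \<epsilon> where "\<epsilon> = (1 - \<theta>) * (inverse (real (Suc m)) / 2)"
    have "0 < \<epsilon>" using \<theta> by (simp add: \<epsilon>_def)
    have "F m \<subseteq> {t. \<forall>k. \<exists>n\<ge>k. t \<in> rich_directions X I (u + \<epsilon>) n}"
    proof
      fix t assume t: "t \<in> F m"
      show "t \<in> {t. \<forall>k. \<exists>n\<ge>k. t \<in> rich_directions X I (u + \<epsilon>) n}"
      proof (rule ccontr)
        assume "t \<notin> {t. \<forall>k. \<exists>n\<ge>k. t \<in> rich_directions X I (u + \<epsilon>) n}"
        then obtain k where "\<And>n. k \<le> n \<Longrightarrow> t \<notin> rich_directions X I (u + \<epsilon>) n" by blast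
        then have "real (card (grid (1 / 2 ^ n) ` (X \<inter> strip t x (1 / 2 ^ n)))) \<le> (2 ^ n) powr (u + \<epsilon>)" if "k \<le> n" for n x
          using t that by (auto simp: rich_directions_def F_def not_less)
        then have "assouad_spectrum \<theta> (proj t ` X) \<le> s + ((u + \<epsilon>) * \<theta> + \<epsilon>) / (1 - \<theta>)"
          using \<open>0 \<le> u\<close> \<open>0 < \<epsilon>\<close> by (intro assouad_spectrum_proj_le[OF X \<open>0 \<le> s\<close> \<theta>, of _ _ k]) auto
        also have "\<dots> = ?f + \<epsilon> * (1 + \<theta>) / (1 - \<theta>)"
          unfolding f[symmetric] by (simp add: algebra_simps add_divide_distrib)
        also have "\<dots> \<le> ?f + inverse (real (Suc m))"
        proof (rule add_left_mono)
          have "\<epsilon> * (1 + \<theta>) / (1 - \<theta>) = \<epsilon> / (1 - \<theta>) * (1 + \<theta>)" by simp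
          also have "\<epsilon> / (1 - \<theta>) = inverse (real (Suc m)) / 2"
            unfolding \<epsilon>_def using \<theta> by (intro nonzero_mult_div_cancel_left) simp
          also have "inverse (real (Suc m)) / 2 * (1 + \<theta>) \<le> inverse (real (Suc m)) / 2 * 2"
            using \<theta> by (intro mult_left_mono) auto
          finally show "\<epsilon> * (1 + \<theta>) / (1 - \<theta>) \<le> inverse (real (Suc m))" by simp
        qed
        finally show False using t by (simp add: F_def)
      qed
    qed
    moreover have "hausdorff_measure \<alpha> {t. \<forall>k. \<exists>n\<ge>k. t \<in> rich_directions X I (u + \<epsilon>) n} = 0"
      unfolding u_def by (rule rich_directions_limsup_null[OF X \<open>0 \<le> s\<close> True \<alpha> \<open>0 < \<epsilon>\<close> I])
    ultimately show ?thesis by (rule hausdorff_measure_null_mono)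
  qed
  then have "hausdorff_measure \<alpha> (\<Union>m. F m) = 0" by (rule hausdorff_measure_null_UN)
  moreover have "{t \<in> I. ?f < assouad_spectrum \<theta> (proj t ` X)} \<subseteq> (\<Union>m. F m)"
  proof
    fix t assume t: "t \<in> {t \<in> I. ?f < assouad_spectrum \<theta> (proj t ` X)}"
    then obtain m where "inverse (real (Suc m)) < assouad_spectrum \<theta> (proj t ` X) - ?f"
      using reals_Archimedean[of "assouad_spectrum \<theta> (proj t ` X) - ?f"] by auto
    then have "t \<in> F m" using t by (simp add: F_def algebra_simps)
    then show "t \<in> (\<Union>m. F m)" by blast
  qed
  ultimately show ?thesis by (rule hausdorff_measure_null_mono[rotated])
qed

theorem theorem2p6:
  fixes I :: "real set" and N :: nat and r s :: real and a b :: "nat \<Rightarrow> real"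
    and K :: "real \<Rightarrow> real set" and X :: "(real \<times> real) set"
  assumes "is_interval I" and "bounded I"
    and "N \<ge> 1"
    and "0 < r" and "r < 1"
    and "\<And>t. t \<in> I \<Longrightarrow> K t = self_similar_set {1..N} (\<lambda>i x. r * x + a i + t * b i)"
    and "X = self_similar_set {1..N} (\<lambda>i p. r *\<^sub>R p + (a i, b i))"
    and "s = ln (real N) / ln (1 / r)"
    and "quasi_assouad_dim X \<le> s"
  shows "(\<forall>\<theta> \<alpha>. 0 < \<theta> \<and> \<theta> < 1 \<and> 0 \<le> \<alpha> \<and> \<alpha> < 1 \<longrightarrow>
            hausdorff_dim {t \<in> I. assouad_spectrum \<theta> (K t) > 1 / (1 + \<alpha>) * (s / (1 - \<theta>) + \<alpha> * s)}
              \<le> ereal \<alpha>)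
       \<and> (\<forall>\<theta>. 0 < \<theta> \<and> \<theta> < 1 \<longrightarrow>
            (AE t in lebesgue. t \<in> I \<longrightarrow>
               assouad_spectrum \<theta> (K t) \<le> 1 / 2 * (s / (1 - \<theta>) + s)))"
proof -
  have J: "finite {1..N}" "{1..N} \<noteq> {}" using assms(3) by auto
  have "compact X" unfolding assms(7) by (rule self_similar_set_props(2)[OF assms(4,5) J])
  then have X: "bounded X" by (rule compact_imp_bounded)
  have K: "K t = proj t ` X" if "t \<in> I" for t
    unfolding assms(6)[OF that] assms(7) by (rule proj_self_similar_set[OF assms(4,5) J])
  have s: "0 \<le> s" unfolding assms(8) using assms(3-5) by (intro divide_nonneg_nonneg ln_ge_zero) auto
  define f where "f \<theta> \<alpha> = 1 / (1 + \<alpha>) * (s / (1 - \<theta>) + \<alpha> * s)" for \<theta> \<alpha>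
  have null: "hausdorff_measure \<alpha> {t \<in> I. assouad_spectrum \<theta> (K t) > f \<theta> \<alpha>} = 0"
    if "0 < \<theta>" "\<theta> < 1" "0 < \<alpha>" "\<alpha> \<le> 1" for \<theta> \<alpha>
  proof -
    have "{t \<in> I. assouad_spectrum \<theta> (K t) > f \<theta> \<alpha>} = {t \<in> I. assouad_spectrum \<theta> (proj t ` X) > f \<theta> \<alpha>}"
      using K by auto
    then show ?thesis
      unfolding f_def using exceptional_directions_null[OF X assms(9) s assms(2) that] by simp
  qed
  have dim: "hausdorff_dim {t \<in> I. assouad_spectrum \<theta> (K t) > f \<theta> \<alpha>} \<le> ereal \<alpha>"
    if \<theta>: "0 < \<theta>" "\<theta> < 1" and \<alpha>: "0 \<le> \<alpha>" "\<alpha> < 1" for \<theta> \<alpha>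
  proof (rule hausdorff_dim_le[OF \<alpha>])
    fix d assume d: "\<alpha> < d" "d < 1"
    have "f \<theta> d \<le> f \<theta> \<alpha>"
    proof -
      have eq: "f \<theta> \<beta> = s + (s / (1 - \<theta>) - s) / (1 + \<beta>)" if "0 \<le> \<beta>" for \<beta>
      proof -
        have "s / (1 - \<theta>) + \<beta> * s = (1 + \<beta>) * s + (s / (1 - \<theta>) - s)" by (simp add: algebra_simps)
        then have "f \<theta> \<beta> = ((1 + \<beta>) * s + (s / (1 - \<theta>) - s)) / (1 + \<beta>)" unfolding f_def by (simp only:) simp
        also have "\<dots> = s + (s / (1 - \<theta>) - s) / (1 + \<beta>)" using that by (subst add_divide_distrib) simp
        finally show ?thesis .
      qed
      have "s * (1 - \<theta>) \<le> s" using s \<theta> by (simp add: mult_left_le)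
      then have "s \<le> s / (1 - \<theta>)" using \<theta> by (simp add: pos_le_divide_eq)
      then have "(s / (1 - \<theta>) - s) / (1 + d) \<le> (s / (1 - \<theta>) - s) / (1 + \<alpha>)"
        using d \<alpha> by (intro divide_left_mono) auto
      then show ?thesis using eq d \<alpha> by simp
    qed
    then show "hausdorff_measure d {t \<in> I. assouad_spectrum \<theta> (K t) > f \<theta> \<alpha>} = 0"
      using \<theta> d \<alpha> by (intro hausdorff_measure_null_mono[OF _ null[of \<theta> d]]) auto
  qed
  have ae: "AE t in lebesgue. t \<in> I \<longrightarrow> assouad_spectrum \<theta> (K t) \<le> f \<theta> 1" if "0 < \<theta>" "\<theta> < 1" for \<theta>
  proof -
    \<comment> \<open>The end point \<open>\<alpha> = 1\<close> of \<open>null\<close>: a set null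
      for one-dimensional Hausdorff measure is Lebesgue null.\<close>
    have "negligible {t \<in> I. assouad_spectrum \<theta> (K t) > f \<theta> 1}"
      using that by (intro hausdorff_measure_1_null_imp_negligible null) auto
    then show ?thesis
      by (intro AE_I'[of "{t \<in> I. assouad_spectrum \<theta> (K t) > f \<theta> 1}"]) (auto simp: negligible_iff_null_sets not_le)
  qed
  show ?thesis using dim ae by (simp add: f_def)
qed

end
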